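(* Let $\epsilon\in\{1,-1\}$, let $g_0$ be a constant, real, symmetric, invertible $2\times2$ matrix, and let $\phi$ be a smooth real function on an open set $U\subset\mathbb{R}^2$ with $\rho=1+\epsilon g_0^{\mu\nu}\phi_{,\mu}\phi_{,\nu}>0$ on $U$. Let $h_{\mu\nu}=g_{0\,\mu\nu}+\epsilon\phi_{,\mu}\phi_{,\nu}$ and assume that the graph of $\phi$ is minimal, i.e. $h^{\mu\nu}\phi_{,\mu\nu}=0$. Let $g_{\alpha\beta}=\rho^{-1/2}h_{\alpha\beta}$ and $\psi_0=-\frac14\log\rho$. Let $r_{\alpha\beta}$, $r$ be the Ricci tensor and Ricci scalar of $h$, and $R_{\alpha\beta}$, $R$ those of $g$. Then $$R=-\frac14\, g^{\alpha\beta}\,\mathrm{tr}\big[(\partial_\alpha g^{-1})\,\partial_\beta g\big],$$ $$R_{\alpha\beta}=-\frac{\rho-1}{2}\,r_{\alpha\beta},$$ $$R=\sqrt{\rho}\,r-2\nabla_g^2\psi_0 .$$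
   Context: Greek indices take the values $1,2$; repeated indices are summed; a comma denotes partial differentiation ($\phi_{,\mu}=\partial_\mu\phi$, $\phi_{,\mu\nu}=\partial_\mu\partial_\nu\phi$). $g_0^{\mu\nu}$, $h^{\mu\nu}$, $g^{\mu\nu}$ are the components of the inverse matrices of $g_0,h,g$. In the first identity $g$ is the $2\times2$ matrix $(g_{\alpha\beta})$, $g^{-1}$ its inverse, and $\mathrm{tr}$ the matrix trace. $\nabla_g^2 u=|\det g|^{-1/2}\partial_\alpha(|\det g|^{1/2}g^{\alpha\beta}\partial_\beta u)$ is the Laplace-Beltrami operator of $g$. The sign convention for the Ricci tensor is the one for which round spheres have positive Ricci curvature; $r=h^{\alpha\beta}r_{\alpha\beta}$, $R=g^{\alpha\beta}R_{\alpha\beta}$. *)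

theory Defs
  imports "HOL-Analysis.Analysis"
begin

definition partial :: "'n::finite \<Rightarrow> (real^'n \<Rightarrow> 'b::real_normed_vector) \<Rightarrow> real^'n \<Rightarrow> 'b" where
  "partial i f x = frechet_derivative f (at x) (axis i 1)"

(* All iterated partial derivatives, the function itself included (is = []), are
   differentiable.  For open U this is the usual notion of C^infinity on U. *)
definition smooth_on :: "(real^'n::finite) set \<Rightarrow> (real^'n \<Rightarrow> 'b::real_normed_vector) \<Rightarrow> bool" where
  "smooth_on U f \<longleftrightarrow> (\<forall>is. foldr partial is f differentiable_on U)"

(* A metric, of arbitrary signature, is given by its component matrix (G x) $ i $ j with
   lower indices; matrix_inv (G x) $ i $ j are the components with upper indices. *)
type_synonym 'n metric = "real^'n \<Rightarrow> real^'n^'n"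

(* christoffel G a b c is the symbol of the Levi-Civita connection with upper index a and
   lower indices b, c. *)
definition christoffel :: "('n::finite) metric \<Rightarrow> 'n \<Rightarrow> 'n \<Rightarrow> 'n \<Rightarrow> real^'n \<Rightarrow> real" where
  "christoffel G a b c x = (1/2) * (\<Sum>d\<in>UNIV. matrix_inv (G x) $ a $ d *
     (partial b (\<lambda>y. G y $ d $ c) x + partial c (\<lambda>y. G y $ d $ b) x
      - partial d (\<lambda>y. G y $ b $ c) x))"

(* riemann G a b c d is the component R^a_{bcd} with
   R(e_c, e_d) e_b = R^a_{bcd} e_a and R(X,Y) = [nabla_X, nabla_Y] - nabla_[X,Y].
   Together with the contraction of a and c below, round spheres have positive Ricci
   curvature. *)
definition riemann ::
    "('n::finite) metric \<Rightarrow> 'n \<Rightarrow> 'n \<Rightarrow> 'n \<Rightarrow> 'n \<Rightarrow> real^'n \<Rightarrow> real" where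
  "riemann G a b c d x =
     partial c (christoffel G a d b) x - partial d (christoffel G a c b) x
     + (\<Sum>e\<in>UNIV. christoffel G a c e x * christoffel G e d b x)
     - (\<Sum>e\<in>UNIV. christoffel G a d e x * christoffel G e c b x)"

definition ricci :: "('n::finite) metric \<Rightarrow> 'n \<Rightarrow> 'n \<Rightarrow> real^'n \<Rightarrow> real" where
  "ricci G b d x = (\<Sum>a\<in>UNIV. riemann G a b a d x)"

definition ricci_scalar :: "('n::finite) metric \<Rightarrow> real^'n \<Rightarrow> real" where
  "ricci_scalar G x = (\<Sum>a\<in>UNIV. \<Sum>b\<in>UNIV. matrix_inv (G x) $ a $ b * ricci G a b x)"

definition laplace_beltrami ::
    "('n::finite) metric \<Rightarrow> (real^'n \<Rightarrow> real) \<Rightarrow> real^'n \<Rightarrow> real" where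
  "laplace_beltrami G u x = \<bar>det (G x)\<bar> powr (-1/2) *
     (\<Sum>a\<in>UNIV. partial a
        (\<lambda>y. \<bar>det (G y)\<bar> powr (1/2) * (\<Sum>b\<in>UNIV. matrix_inv (G y) $ a $ b * partial b u y)) x)"

end

theory Submission
  imports Defs
begin

text \<open>
  Write \<open>P\<^sup>a = g\<^sub>0\<^sup>a\<^sup>b \<phi>\<^sub>,\<^sub>b\<close> and \<open>w\<^sub>a = P\<^sup>d \<phi>\<^sub>,\<^sub>d\<^sub>a\<close>. Then \<open>h\<close> has the Christoffel symbols
  \<open>\<epsilon> P\<^sup>a \<phi>\<^sub>,\<^sub>b\<^sub>c / \<rho>\<close> and the Ricci tensor \<open>K h\<close>, where \<open>K = \<epsilon> det (\<phi>\<^sub>,\<^sub>a\<^sub>b) / (\<rho> det h)\<close>, and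
  \<open>g = exp (2 \<psi>\<^sub>0) h\<close>, so that \<open>Ric\<^sub>g = Ric\<^sub>h - (\<Delta>\<^sub>h \<psi>\<^sub>0) h\<close> in dimension two. For a minimal graph the
  Cayley--Hamilton theorem gives \<open>h\<^sup>a\<^sup>b w\<^sub>a w\<^sub>b = -\<rho>\<^sup>2 (\<rho> - 1) K\<close>; together with the derivative of the
  minimality equation, which eliminates the third derivatives of \<open>\<phi>\<close>, this yields
  \<open>\<Delta>\<^sub>h \<psi>\<^sub>0 = (\<rho> + 1) K / 2\<close>. All three curvature identities thereby reduce to multiples of \<open>K\<close>.
\<close>

section \<open>Partial derivatives\<close>

text \<open>A derivative at a point only depends on the function near it, so both functions admit
  the same candidates and the choice in \<open>frechet_derivative\<close> picks the same one. Most
  closed formulas below hold only on an open set; this is what lets them be differentiated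
  again.\<close>

lemma partial_cong:
  assumes "open S" "x \<in> S" "\<And>y. y \<in> S \<Longrightarrow> f y = f' y"
  shows "partial i f x = partial i f' x"
proof -
  have "(f has_derivative D) (at x) \<longleftrightarrow> (f' has_derivative D) (at x)" for D
    using assms has_derivative_transform_within_open[of _ _ x UNIV S] by metis
  then show ?thesis
    by (simp add: partial_def frechet_derivative_def)
qed

lemma differentiable_transform_open:
  assumes "f differentiable at x" "open S" "x \<in> S" "\<And>y. y \<in> S \<Longrightarrow> f y = f' y"
  shows "f' differentiable at x"
  using assms has_derivative_transform_within_open unfolding differentiable_def by blast

lemma partial_eqI: "(f has_derivative D) (at x) \<Longrightarrow> partial i f x = D (axis i 1)"
  by (metis partial_def frechet_derivative_at)

lemma has_derivative_frechet:
  "f differentiable at x \<Longrightarrow> (f has_derivative frechet_derivative f (at x)) (at x)"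
  by (simp add: frechet_derivative_works)

lemma partial_const [simp]: "partial i (\<lambda>y. c) x = 0"
  by (simp add: partial_def)

lemma partial_add:
  assumes "f differentiable at x" "f' differentiable at x"
  shows "partial i (\<lambda>y. f y + f' y) x = partial i f x + partial i f' x"
  using partial_eqI[OF has_derivative_add[OF assms[THEN has_derivative_frechet]]]
  by (simp add: partial_def)

lemma partial_diff:
  assumes "f differentiable at x" "f' differentiable at x"
  shows "partial i (\<lambda>y. f y - f' y) x = partial i f x - partial i f' x"
  using partial_eqI[OF has_derivative_diff[OF assms[THEN has_derivative_frechet]]]
  by (simp add: partial_def)

lemma partial_sum:
  assumes "\<And>j. j \<in> J \<Longrightarrow> f j differentiable at x"
  shows "partial i (\<lambda>y. \<Sum>j\<in>J. f j y) x = (\<Sum>j\<in>J. partial i (f j) x)"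
  using partial_eqI[OF has_derivative_sum[of J f, OF has_derivative_frechet[OF assms]]]
  by (simp add: partial_def)

lemma partial_mult:
  fixes f :: "real^'n::finite \<Rightarrow> real"
  assumes "f differentiable at x" "f' differentiable at x"
  shows "partial i (\<lambda>y. f y * f' y) x = partial i f x * f' x + f x * partial i f' x"
  using partial_eqI[OF has_derivative_mult[OF assms[THEN has_derivative_frechet]]]
  by (simp add: partial_def)

lemma partial_divide:
  fixes f :: "real^'n::finite \<Rightarrow> real"
  assumes "f differentiable at x" "f' differentiable at x" "f' x \<noteq> 0"
  shows "partial i (\<lambda>y. f y / f' y) x
    = partial i f x / f' x - f x * partial i f' x / (f' x)\<^sup>2"
  using partial_eqI[OF has_derivative_divide[OF assms(1,2)[THEN has_derivative_frechet] assms(3)]]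
    assms(3)
  by (simp add: partial_def field_simps power2_eq_square)

lemma partial_compose_real:
  fixes f :: "real^'n::finite \<Rightarrow> real"
  assumes "f differentiable at x" "(F has_real_derivative D) (at (f x))"
  shows "partial i (\<lambda>y. F (f y)) x = D * partial i f x"
    and "(\<lambda>y. F (f y)) differentiable at x"
proof -
  have *: "((\<lambda>y. F (f y)) has_derivative (\<lambda>v. D * frechet_derivative f (at x) v)) (at x)"
    using has_derivative_compose[OF has_derivative_frechet[OF assms(1)], of F "(*) D"] assms(2)
    by (simp add: has_field_derivative_def)
  show "partial i (\<lambda>y. F (f y)) x = D * partial i f x"
    using partial_eqI[OF *] by (simp add: partial_def)
  show "(\<lambda>y. F (f y)) differentiable at x"
    using * by (rule differentiableI)
qed

text \<open>The trace identity differentiates matrix-valued functions, whereas all computations use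
  entries; this passes from one to the other.\<close>

lemma partial_nth_nth:
  fixes F :: "real^'n::finite \<Rightarrow> real^'m::finite^'l::finite"
  assumes "\<And>i j. (\<lambda>y. F y $ i $ j) differentiable at x"
  shows "partial a F x $ i $ j = partial a (\<lambda>y. F y $ i $ j) x"
proof -
  have "F differentiable at x"
    using assms by (auto simp: differentiable_componentwise_within[of F] Basis_vec_def inner_axis)
  note * = has_derivative_frechet[OF this]
  have "((\<lambda>y. F y $ i $ j) has_derivative (\<lambda>v. frechet_derivative F (at x) v $ i $ j)) (at x)"
    by (rule bounded_linear.has_derivative[OF _ *])
      (intro bounded_linear_compose[OF bounded_linear_vec_nth] bounded_linear_vec_nth)
  from partial_eqI[OF this] show ?thesis
    by (simp add: partial_def)
qed

section \<open>Symmetry of mixed partial derivatives\<close>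

lemma has_real_derivative_line:
  fixes f :: "real^'n::finite \<Rightarrow> real"
  assumes "f differentiable at (x + t *\<^sub>R axis i 1)"
  shows "((\<lambda>t. f (x + t *\<^sub>R axis i 1)) has_real_derivative partial i f (x + t *\<^sub>R axis i 1)) (at t)"
proof -
  let ?D = "frechet_derivative f (at (x + t *\<^sub>R axis i 1))"
  have "((\<lambda>t. x + t *\<^sub>R axis i 1) has_derivative (\<lambda>s. s *\<^sub>R axis i 1)) (at t)"
    by (auto intro!: derivative_eq_intros)
  from has_derivative_compose[OF this has_derivative_frechet[OF assms]]
  have "((\<lambda>t. f (x + t *\<^sub>R axis i 1)) has_derivative (\<lambda>s. ?D (s *\<^sub>R axis i 1))) (at t)" .
  moreover have "?D (s *\<^sub>R axis i 1) = partial i f (x + t *\<^sub>R axis i 1) * s" for s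
    using linear_frechet_derivative[OF assms] by (simp add: partial_def linear_scale)
  ultimately show ?thesis
    by (simp add: has_field_derivative_def)
qed

text \<open>The mean value theorem is applied twice: in direction \<open>i\<close> to the difference
  \<open>F\<close> of \<open>f\<close> along two parallel segments, then in direction
  \<open>j\<close> to \<open>partial i f\<close>.\<close>

lemma second_difference_mvt:
  fixes f :: "real^'n::finite \<Rightarrow> real"
  assumes ball: "ball x r \<subseteq> S" and t: "0 < t" "2 * t < r"
    and f: "\<And>y. y \<in> S \<Longrightarrow> f differentiable at y"
    and fi: "\<And>y. y \<in> S \<Longrightarrow> partial i f differentiable at y"
  obtains y where "dist x y \<le> 2 * t"
    "f (x + t *\<^sub>R axis i 1 + t *\<^sub>R axis j 1) - f (x + t *\<^sub>R axis i 1)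
      - f (x + t *\<^sub>R axis j 1) + f x = t\<^sup>2 * partial j (partial i f) y"
proof -
  have d: "dist x (x + \<sigma> *\<^sub>R axis i 1 + \<tau> *\<^sub>R axis j 1) \<le> 2 * t"
    if "0 \<le> \<sigma>" "\<sigma> \<le> t" "0 \<le> \<tau>" "\<tau> \<le> t" for \<sigma> \<tau>
  proof -
    have "norm (\<sigma> *\<^sub>R axis i 1 + \<tau> *\<^sub>R axis j 1 :: real^'n)
      \<le> norm (\<sigma> *\<^sub>R axis i 1 :: real^'n) + norm (\<tau> *\<^sub>R axis j 1 :: real^'n)"
      by (rule norm_triangle_ineq)
    also have "\<dots> \<le> 2 * t" using that by simp
    finally show ?thesis by (simp add: dist_norm algebra_simps norm_minus_commute)
  qed
  have S: "x + \<sigma> *\<^sub>R axis i 1 + \<tau> *\<^sub>R axis j 1 \<in> S"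
    if "0 \<le> \<sigma>" "\<sigma> \<le> t" "0 \<le> \<tau>" "\<tau> \<le> t" for \<sigma> \<tau>
    using d[OF that] t ball by (auto simp: subset_iff)
  define F where "F s = f ((x + t *\<^sub>R axis j 1) + s *\<^sub>R axis i 1) - f (x + s *\<^sub>R axis i 1)" for s
  have F: "(F has_real_derivative
      partial i f ((x + t *\<^sub>R axis j 1) + s *\<^sub>R axis i 1) - partial i f (x + s *\<^sub>R axis i 1)) (at s)"
    if "0 \<le> s" "s \<le> t" for s
    unfolding F_def using S[OF that, of t] S[OF that, of 0] t
    by (intro DERIV_diff has_real_derivative_line f) (simp_all add: algebra_simps)
  from MVT2[OF t(1) F] obtain \<sigma> where \<sigma>: "0 < \<sigma>" "\<sigma> < t" and 1: "F t - F 0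
      = t * (partial i f ((x + t *\<^sub>R axis j 1) + \<sigma> *\<^sub>R axis i 1) - partial i f (x + \<sigma> *\<^sub>R axis i 1))"
    by auto
  define H where "H s = partial i f ((x + \<sigma> *\<^sub>R axis i 1) + s *\<^sub>R axis j 1)" for s
  have H: "(H has_real_derivative
      partial j (partial i f) ((x + \<sigma> *\<^sub>R axis i 1) + s *\<^sub>R axis j 1)) (at s)"
    if "0 \<le> s" "s \<le> t" for s
    unfolding H_def using S[of \<sigma> s] that \<sigma>
    by (intro has_real_derivative_line fi) simp
  from MVT2[OF t(1) H] obtain \<tau> where \<tau>: "0 < \<tau>" "\<tau> < t" and 2: "H t - H 0
      = t * partial j (partial i f) ((x + \<sigma> *\<^sub>R axis i 1) + \<tau> *\<^sub>R axis j 1)"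
    by auto
  have "F t - F 0 = t * (H t - H 0)"
    using 1 by (simp add: H_def algebra_simps)
  then have "F t - F 0 = t\<^sup>2 * partial j (partial i f) (x + \<sigma> *\<^sub>R axis i 1 + \<tau> *\<^sub>R axis j 1)"
    using 2 by (simp add: power2_eq_square)
  then show thesis
    using d[of \<sigma> \<tau>] \<sigma> \<tau> by (intro that) (auto simp: F_def algebra_simps)
qed

text \<open>The second difference is symmetric in \<open>i\<close> and \<open>j\<close>, so the two
  mixed derivatives take a common value at points arbitrarily close to \<open>x\<close>; continuity
  makes them agree at \<open>x\<close>.\<close>

lemma partial_commute:
  fixes f :: "real^'n::finite \<Rightarrow> real"
  assumes "open S" "x \<in> S"
    and f: "\<And>y. y \<in> S \<Longrightarrow> f differentiable at y"
    and fi: "\<And>k y. y \<in> S \<Longrightarrow> partial k f differentiable at y"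
    and cont: "\<And>k l. isCont (partial k (partial l f)) x"
  shows "partial i (partial j f) x = partial j (partial i f) x"
proof (rule ccontr)
  assume ne: "partial i (partial j f) x \<noteq> partial j (partial i f) x"
  \<comment> \<open>With half the gap as tolerance, nearby values of the two mixed derivatives lie
    in disjoint intervals.\<close>
  define e where "e = \<bar>partial i (partial j f) x - partial j (partial i f) x\<bar> / 2"
  have e: "e > 0" using ne by (simp add: e_def)
  obtain r where r: "r > 0" "ball x r \<subseteq> S"
    using assms(1,2) openE by blast
  obtain d1 where d1: "d1 > 0"
    "\<And>y. dist x y < d1 \<Longrightarrow> \<bar>partial i (partial j f) y - partial i (partial j f) x\<bar> < e"
    using cont[of i j] e unfolding continuous_at_eps_delta by (metis dist_commute dist_real_def)
  obtain d2 where d2: "d2 > 0"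
    "\<And>y. dist x y < d2 \<Longrightarrow> \<bar>partial j (partial i f) y - partial j (partial i f) x\<bar> < e"
    using cont[of j i] e unfolding continuous_at_eps_delta by (metis dist_commute dist_real_def)
  \<comment> \<open>The intermediate points lie within \<open>2 * t\<close> of \<open>x\<close>, so
    a third of the smallest radius keeps them strictly inside all three balls.\<close>
  define t where "t = min r (min d1 d2) / 3"
  have t: "t > 0" "2 * t < r" "2 * t < d1" "2 * t < d2"
    using r d1 d2 by (auto simp: t_def min_def)
  obtain y where y: "dist x y \<le> 2 * t"
    "f (x + t *\<^sub>R axis i 1 + t *\<^sub>R axis j 1) - f (x + t *\<^sub>R axis i 1)
      - f (x + t *\<^sub>R axis j 1) + f x = t\<^sup>2 * partial j (partial i f) y"
    using second_difference_mvt[OF r(2) t(1,2) f fi] by blast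
  obtain z where z: "dist x z \<le> 2 * t"
    "f (x + t *\<^sub>R axis j 1 + t *\<^sub>R axis i 1) - f (x + t *\<^sub>R axis j 1)
      - f (x + t *\<^sub>R axis i 1) + f x = t\<^sup>2 * partial i (partial j f) z"
    using second_difference_mvt[OF r(2) t(1,2) f fi] by blast
  have "t\<^sup>2 * partial j (partial i f) y = t\<^sup>2 * partial i (partial j f) z"
    unfolding y(2)[symmetric] z(2)[symmetric] by (simp add: algebra_simps)
  then have "partial j (partial i f) y = partial i (partial j f) z"
    using t by simp
  moreover have "\<bar>partial j (partial i f) y - partial j (partial i f) x\<bar> < e"
    using d2(2) y(1) t by simp
  moreover have "\<bar>partial i (partial j f) z - partial i (partial j f) x\<bar> < e"
    using d1(2) z(1) t by simp
  ultimately show False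
    by (simp add: e_def abs_if split: if_splits)
qed

lemma smooth_on_differentiable_at:
  assumes "open S" "smooth_on S f" "x \<in> S"
  shows "foldr partial is f differentiable at x"
  using assms differentiable_on_eq_differentiable_at unfolding smooth_on_def by blast

lemma smooth_on_partial:
  assumes "smooth_on S f"
  shows "smooth_on S (partial i f)"
  unfolding smooth_on_def
proof
  fix "is"
  have "foldr partial (is @ [i]) f differentiable_on S"
    using assms unfolding smooth_on_def by blast
  then show "foldr partial is (partial i f) differentiable_on S" by simp
qed

lemma smooth_on_imp_differentiable:
  assumes "open S" "smooth_on S f" "x \<in> S"
  shows "f differentiable at x"
  using smooth_on_differentiable_at[OF assms, of "[]"] by simp

lemma smooth_on_partial_commute:
  fixes f :: "real^'n::finite \<Rightarrow> real"
  assumes "open S" "smooth_on S f" "x \<in> S"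
  shows "partial i (partial j f) x = partial j (partial i f) x"
  using assms
  by (intro partial_commute[of S] differentiable_imp_continuous_within)
    (auto intro: smooth_on_imp_differentiable smooth_on_partial)

lemma matrix_inv_eqI:
  fixes A B :: "real^'n::finite^'n"
  assumes "A ** B = mat 1"
  shows "matrix_inv A = B"
proof -
  have "B ** A = mat 1" using assms matrix_left_right_inverse by blast
  then have "A ** matrix_inv A = mat 1 \<and> matrix_inv A ** A = mat 1"
    unfolding matrix_inv_def using assms by (metis (mono_tags, lifting) someI)
  then show ?thesis
    by (metis \<open>B ** A = mat 1\<close> matrix_mul_assoc matrix_mul_lid matrix_mul_rid)
qed

section \<open>Inverse matrices, Christoffel symbols and conformal changes\<close>

lemma invertible_inv:
  fixes A :: "real^'n::finite^'n"
  assumes "invertible A"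
  shows "A ** matrix_inv A = mat 1" "matrix_inv A ** A = mat 1"
  using assms unfolding invertible_def matrix_inv_def by (metis (mono_tags, lifting) someI_ex)+

text \<open>Raising an index and lowering it again, or the reverse, does nothing; stated with nested
  sums, as index expressions occur below.\<close>

lemma sum_matrix_inv_cancel:
  fixes A :: "real^'n::finite^'n"
  assumes "invertible A"
  shows "(\<Sum>a\<in>UNIV. A $ b $ a * (\<Sum>d\<in>UNIV. matrix_inv A $ a $ d * v d)) = v b"
    and "(\<Sum>a\<in>UNIV. matrix_inv A $ b $ a * (\<Sum>d\<in>UNIV. A $ a $ d * v d)) = v b"
proof -
  have "A *v (matrix_inv A *v (\<chi> i. v i)) = (\<chi> i. v i)"
    and "matrix_inv A *v (A *v (\<chi> i. v i)) = (\<chi> i. v i)"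
    using invertible_inv[OF assms] by (simp_all add: matrix_vector_mul_assoc)
  then show "(\<Sum>a\<in>UNIV. A $ b $ a * (\<Sum>d\<in>UNIV. matrix_inv A $ a $ d * v d)) = v b"
    and "(\<Sum>a\<in>UNIV. matrix_inv A $ b $ a * (\<Sum>d\<in>UNIV. A $ a $ d * v d)) = v b"
    by (simp_all add: vec_eq_iff matrix_vector_mult_def)
qed

lemma sum_matrix_inv_mult:
  fixes A :: "real^'n::finite^'n"
  assumes "invertible A"
  shows "(\<Sum>d\<in>UNIV. A $ a $ d * matrix_inv A $ d $ c) = (if a = c then 1 else 0)"
    and "(\<Sum>d\<in>UNIV. matrix_inv A $ a $ d * A $ d $ c) = (if a = c then 1 else 0)"
  using invertible_inv[OF assms] by (simp_all add: vec_eq_iff matrix_matrix_mult_def mat_def)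

lemma symmetric_nth: "transpose A = A \<Longrightarrow> A $ a $ b = A $ b $ a"
  by (auto simp: transpose_def vec_eq_iff)

lemma matrix_inv_symmetric:
  fixes A :: "real^'n::finite^'n"
  assumes "transpose A = A" "invertible A"
  shows "matrix_inv A $ a $ b = matrix_inv A $ b $ a"
proof -
  have "A ** transpose (matrix_inv A) = mat 1"
    by (metis assms invertible_inv(2) matrix_transpose_mul transpose_mat)
  then have "transpose (matrix_inv A) = matrix_inv A"
    by (rule matrix_inv_eqI[symmetric])
  then show ?thesis
    by (rule symmetric_nth)
qed

text \<open>The scalar relations behind \<open>A ** matrix_inv A = mat 1\<close>, with each
  symmetric pair of entries named by its (1,2) member. They are the side relations for the
  polynomial identities that \<open>algebra\<close> proves in dimension two.\<close>

lemma symmetric_matrix_inv_mult_2: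
  fixes A :: "real^2^2"
  assumes A: "transpose A = A" "invertible A"
  shows "A $ 1 $ 1 * matrix_inv A $ 1 $ 1 + A $ 1 $ 2 * matrix_inv A $ 1 $ 2 = 1"
    and "A $ 1 $ 1 * matrix_inv A $ 1 $ 2 + A $ 1 $ 2 * matrix_inv A $ 2 $ 2 = 0"
    and "A $ 1 $ 2 * matrix_inv A $ 1 $ 1 + A $ 2 $ 2 * matrix_inv A $ 1 $ 2 = 0"
    and "A $ 1 $ 2 * matrix_inv A $ 1 $ 2 + A $ 2 $ 2 * matrix_inv A $ 2 $ 2 = 1"
  using sum_matrix_inv_mult(1)[OF A(2), of 1 1] sum_matrix_inv_mult(1)[OF A(2), of 1 2]
    sum_matrix_inv_mult(1)[OF A(2), of 2 1] sum_matrix_inv_mult(1)[OF A(2), of 2 2]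
    symmetric_nth[OF A(1), of 2 1] matrix_inv_symmetric[OF A, of 2 1] by (simp_all add: sum_2)

lemma matrix_inv_scaleR:
  fixes A :: "real^'n::finite^'n"
  assumes "invertible A" "c \<noteq> 0"
  shows "matrix_inv (c *\<^sub>R A) = inverse c *\<^sub>R matrix_inv A"
  using invertible_inv[OF assms(1)] assms(2)
  by (intro matrix_inv_eqI) (simp add: scalar_matrix_assoc matrix_scalar_ac flip: scalar_mult_eq_scaleR)

section \<open>Locality of the curvature, and cancellation of a conformal factor\<close>

lemma christoffel_cong:
  assumes "open S" "x \<in> S" "\<And>y. y \<in> S \<Longrightarrow> G y = G' y"
  shows "christoffel G a b c x = christoffel G' a b c x"
proof -
  have "partial e (\<lambda>y. G y $ i $ j) x = partial e (\<lambda>y. G' y $ i $ j) x" for e i j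
    using assms by (intro partial_cong[of S]) auto
  then show ?thesis
    by (simp add: christoffel_def assms)
qed

lemma riemann_cong:
  assumes "open S" "x \<in> S" "\<And>y. y \<in> S \<Longrightarrow> G y = G' y"
  shows "riemann G a b c d x = riemann G' a b c d x"
proof -
  have "christoffel G i j k y = christoffel G' i j k y" if "y \<in> S" for i j k y
    using christoffel_cong[OF assms(1) that assms(3)] .
  moreover from this have "partial e (christoffel G i j k) x = partial e (christoffel G' i j k) x" for e i j k
    using assms by (intro partial_cong[of S]) auto
  ultimately show ?thesis
    by (simp add: riemann_def assms)
qed

lemma ricci_cong:
  assumes "open S" "x \<in> S" "\<And>y. y \<in> S \<Longrightarrow> G y = G' y"
  shows "ricci G a b x = ricci G' a b x"
  unfolding ricci_def by (intro sum.cong refl riemann_cong[OF assms])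

text \<open>One summand of a Christoffel symbol of \<open>exp (2 * u y) *\<^sub>R G y\<close>:
  \<open>e\<close> and \<open>i\<close> are the conformal factor and its inverse, \<open>k\<close>
  an entry of the inverse of \<open>G\<close>, the letters \<open>p\<close>, \<open>q\<close>,
  \<open>r\<close> derivatives of \<open>u\<close> and \<open>A\<close>, \<open>B\<close>,
  \<open>C\<close> those of \<open>G\<close>.\<close>

lemma conformal_factor_cancel:
  fixes e :: real
  assumes "i * e = 1"
  shows "1/2 * (i * k * (e * (2 * p * g1 + A) + e * (2 * q * g2 + B) - e * (2 * r * g3 + C)))
    = k * (p * g1) + k * (q * g2) - g3 * (k * r) + 1/2 * (k * (A + B - C))"
proof -
  have "1/2 * (i * k * (e * (2 * p * g1 + A) + e * (2 * q * g2 + B) - e * (2 * r * g3 + C)))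
      = (i * e) * (k * (p * g1) + k * (q * g2) - g3 * (k * r) + 1/2 * (k * (A + B - C)))"
    by algebra
  then show ?thesis unfolding assms mult_1 .
qed

section \<open>The Levi-Civita connection in coordinates\<close>

locale metric_on =
  fixes S :: "(real^'n::finite) set" and G :: "'n metric"
  assumes open_S: "open S"
    and sym: "\<And>y. y \<in> S \<Longrightarrow> transpose (G y) = G y"
    and inv: "\<And>y. y \<in> S \<Longrightarrow> invertible (G y)"
    and diff: "\<And>y i j. y \<in> S \<Longrightarrow> (\<lambda>y. G y $ i $ j) differentiable at y"
    and diff_inv: "\<And>y i j. y \<in> S \<Longrightarrow> (\<lambda>y. matrix_inv (G y) $ i $ j) differentiable at y"
begin

lemma sym_nth: "y \<in> S \<Longrightarrow> G y $ a $ b = G y $ b $ a"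
  using sym by (rule symmetric_nth)

lemma sym_inv: "y \<in> S \<Longrightarrow> matrix_inv (G y) $ a $ b = matrix_inv (G y) $ b $ a"
  by (simp add: inv matrix_inv_symmetric sym)

lemma partial_sym: "y \<in> S \<Longrightarrow> partial e (\<lambda>y. G y $ a $ b) y = partial e (\<lambda>y. G y $ b $ a) y"
  using open_S sym_nth by (intro partial_cong[of S]) auto

lemma christoffel_sym: "y \<in> S \<Longrightarrow> christoffel G a b c y = christoffel G a c b y"
  unfolding christoffel_def by (simp add: partial_sym[of y _ b c] add.commute)

lemma partial_christoffel_sym:
  "y \<in> S \<Longrightarrow> partial e (christoffel G a b c) y = partial e (christoffel G a c b) y"
  using open_S christoffel_sym by (intro partial_cong[of S]) auto

lemma lower_christoffel:
  assumes "y \<in> S"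
  shows "(\<Sum>a\<in>UNIV. G y $ d $ a * christoffel G a b c y)
    = (partial b (\<lambda>y. G y $ d $ c) y + partial c (\<lambda>y. G y $ d $ b) y
      - partial d (\<lambda>y. G y $ b $ c) y) / 2"
  using sum_matrix_inv_cancel(1)[OF inv[OF assms], where b=d
      and v="\<lambda>d. (partial b (\<lambda>y. G y $ d $ c) y + partial c (\<lambda>y. G y $ d $ b) y
      - partial d (\<lambda>y. G y $ b $ c) y) / 2"]
  by (simp add: christoffel_def sum_divide_distrib)

text \<open>Metric compatibility of the connection. In the sum of the two lowered symbols all
  derivatives of the metric cancel except the one wanted, which occurs twice.\<close>

lemma partial_metric:
  assumes "y \<in> S"
  shows "partial e (\<lambda>y. G y $ b $ c) y
    = (\<Sum>a\<in>UNIV. G y $ b $ a * christoffel G a e c y) + (\<Sum>a\<in>UNIV. G y $ c $ a * christoffel G a e b y)"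
  unfolding lower_christoffel[OF assms]
  using partial_sym[OF assms, of e c b] partial_sym[OF assms, of b e c] partial_sym[OF assms, of c e b]
  by (simp add: field_simps)

text \<open>The product of \<open>G\<close> and its inverse is constant on \<open>S\<close>; its
  derivative vanishes, and the resulting relation is solved by applying the inverse matrix.\<close>

lemma partial_matrix_inv:
  assumes y: "y \<in> S"
  shows "partial e (\<lambda>y. matrix_inv (G y) $ a $ d) y
    = - (\<Sum>b\<in>UNIV. matrix_inv (G y) $ a $ b
          * (\<Sum>c\<in>UNIV. partial e (\<lambda>y. G y $ b $ c) y * matrix_inv (G y) $ c $ d))"
proof -
  have "partial e (\<lambda>y. \<Sum>c\<in>UNIV. G y $ b $ c * matrix_inv (G y) $ c $ d) y = 0" for b
    using partial_cong[OF open_S y, of "\<lambda>y. \<Sum>c\<in>UNIV. G y $ b $ c * matrix_inv (G y) $ c $ d"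
        "\<lambda>y. if b = d then 1 else 0"]
    by (simp add: sum_matrix_inv_mult inv)
  then have *: "(\<Sum>c\<in>UNIV. partial e (\<lambda>y. G y $ b $ c) y * matrix_inv (G y) $ c $ d)
      = - (\<Sum>c\<in>UNIV. G y $ b $ c * partial e (\<lambda>y. matrix_inv (G y) $ c $ d) y)" for b
    by (simp add: partial_sum partial_mult diff diff_inv y sum.distrib eq_neg_iff_add_eq_0)
  show ?thesis
    unfolding * using sum_matrix_inv_cancel(2)[OF inv[OF y], of a
        "\<lambda>c. partial e (\<lambda>y. matrix_inv (G y) $ c $ d) y"]
    by (simp add: sum_negf)
qed

text \<open>The inverse metric is parallel as well: compatibility is inserted into the derivative of
  the inverse, and each of its two terms contracts to one Christoffel term.\<close>

lemma partial_matrix_inv_christoffel: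
  assumes y: "y \<in> S"
  shows "partial e (\<lambda>y. matrix_inv (G y) $ a $ d) y
    = - (\<Sum>m\<in>UNIV. christoffel G a e m y * matrix_inv (G y) $ m $ d)
      - (\<Sum>m\<in>UNIV. christoffel G d e m y * matrix_inv (G y) $ m $ a)"
proof -
  have 1: "(\<Sum>b\<in>UNIV. matrix_inv (G y) $ a $ b * (\<Sum>c\<in>UNIV. (\<Sum>m\<in>UNIV. G y $ b $ m * \<Gamma> m c) * matrix_inv (G y) $ c $ d))
     = (\<Sum>c\<in>UNIV. \<Gamma> a c * matrix_inv (G y) $ c $ d)" for a d \<Gamma>
  proof -
    have "(\<Sum>c\<in>UNIV. (\<Sum>m\<in>UNIV. G y $ b $ m * \<Gamma> m c) * matrix_inv (G y) $ c $ d)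
       = (\<Sum>m\<in>UNIV. G y $ b $ m * (\<Sum>c\<in>UNIV. \<Gamma> m c * matrix_inv (G y) $ c $ d))" for b
      unfolding sum_distrib_left sum_distrib_right by (subst sum.swap) (simp add: mult.assoc)
    then show ?thesis
      using sum_matrix_inv_cancel(2)[OF inv[OF y]] by simp
  qed
  have 2: "(\<Sum>b\<in>UNIV. matrix_inv (G y) $ a $ b * (\<Sum>c\<in>UNIV. (\<Sum>m\<in>UNIV. G y $ c $ m * \<Gamma> m b) * matrix_inv (G y) $ c $ d))
     = (\<Sum>c\<in>UNIV. \<Gamma> d c * matrix_inv (G y) $ c $ a)" for \<Gamma>
  proof -
    have "(\<Sum>b\<in>UNIV. matrix_inv (G y) $ a $ b * (\<Sum>c\<in>UNIV. (\<Sum>m\<in>UNIV. G y $ c $ m * \<Gamma> m b) * matrix_inv (G y) $ c $ d))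
      = (\<Sum>c\<in>UNIV. matrix_inv (G y) $ d $ c * (\<Sum>b\<in>UNIV. (\<Sum>m\<in>UNIV. G y $ c $ m * \<Gamma> m b) * matrix_inv (G y) $ b $ a))"
      unfolding sum_distrib_left
      by (subst sum.swap) (simp add: sym_inv[OF y, of a] sym_inv[OF y, of d] mult_ac)
    with 1 show ?thesis by simp
  qed
  show ?thesis
    unfolding partial_matrix_inv[OF y] partial_metric[OF y] distrib_right sum.distrib distrib_left
      1 2 by simp
qed

text \<open>The product rule adds derivatives of \<open>u\<close> times \<open>G\<close> to the
  lowered symbols, while the exponentials cancel. Raising the index turns two of the three new terms
  into Kronecker deltas and the third into the gradient of \<open>u\<close>.\<close>

lemma christoffel_conformal:
  assumes y: "y \<in> S" and u: "u differentiable at y"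
  shows "christoffel (\<lambda>y. exp (2 * u y) *\<^sub>R G y) a b c y
    = christoffel G a b c y + (if a = c then partial b u y else 0) + (if a = b then partial c u y else 0)
      - G y $ b $ c * (\<Sum>d\<in>UNIV. matrix_inv (G y) $ a $ d * partial d u y)" (is "_ = ?rhs")
proof -
  have D: "((\<lambda>t. exp (2 * t)) has_real_derivative 2 * exp (2 * u y)) (at (u y))"
    by (auto intro!: derivative_eq_intros)
  note e = partial_compose_real(1)[OF u D] and d = partial_compose_real(2)[OF u D]
  have p: "partial i (\<lambda>y. exp (2 * u y) * G y $ j $ k) y
     = exp (2 * u y) * (2 * partial i u y * G y $ j $ k + partial i (\<lambda>y. G y $ j $ k) y)" for i j k
    unfolding partial_mult[OF d diff[OF y]] e by (simp add: algebra_simps)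
  have k: "(\<Sum>d\<in>UNIV. matrix_inv (G y) $ a $ d * (v * G y $ d $ j)) = (if a = j then v else 0)" for v j
    using sum_matrix_inv_mult(2)[OF inv[OF y], of a j]
    by (simp add: mult.left_commute[of _ v] flip: sum_distrib_left)
  have m: "matrix_inv (exp (2 * u y) *\<^sub>R G y) $ i $ j = inverse (exp (2 * u y)) * matrix_inv (G y) $ i $ j" for i j
    by (simp add: matrix_inv_scaleR inv[OF y])
  have "christoffel (\<lambda>y. exp (2 * u y) *\<^sub>R G y) a b c y
    = (\<Sum>d\<in>UNIV. matrix_inv (G y) $ a $ d * (partial b u y * G y $ d $ c)
        + matrix_inv (G y) $ a $ d * (partial c u y * G y $ d $ b)
        - G y $ b $ c * (matrix_inv (G y) $ a $ d * partial d u y)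
        + 1/2 * (matrix_inv (G y) $ a $ d * (partial b (\<lambda>y. G y $ d $ c) y + partial c (\<lambda>y. G y $ d $ b) y
        - partial d (\<lambda>y. G y $ b $ c) y)))"
    unfolding christoffel_def sum_distrib_left m vector_scaleR_component real_scaleR_def p
    by (intro sum.cong refl conformal_factor_cancel) simp
  also have "\<dots> = ?rhs"
    unfolding sum.distrib sum_subtractf k sum_distrib_left[symmetric] christoffel_def by simp
  finally show ?thesis .
qed

end

section \<open>Conformal change of the Ricci tensor in dimension two\<close>

locale metric2_on = metric_on S G for S :: "(real^2) set" and G :: "2 metric" +
  assumes diff_christoffel: "\<And>y a b c. y \<in> S \<Longrightarrow> christoffel G a b c differentiable at y"
begin

text \<open>The general formula has further terms with the factor n - 2; in dimension two only the
  Laplacian of \<open>u\<close>, here the trace of its covariant Hessian, survives.\<close>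

lemma ricci_conformal:
  assumes y: "y \<in> S"
    and du: "\<And>z. z \<in> S \<Longrightarrow> u differentiable at z"
    and ddu: "\<And>a. partial a u differentiable at y"
    and commute: "\<And>a c. partial a (partial c u) y = partial c (partial a u) y"
  shows "ricci (\<lambda>y. exp (2 * u y) *\<^sub>R G y) b d y = ricci G b d y
    - (\<Sum>a\<in>UNIV. \<Sum>c\<in>UNIV. matrix_inv (G y) $ a $ c *
        (partial a (partial c u) y - (\<Sum>e\<in>UNIV. christoffel G e a c y * partial e u y))) * G y $ b $ d"
    (is "?P b d")
proof -
  let ?G = "\<lambda>y. exp (2 * u y) *\<^sub>R G y"
  define U where "U a y = (\<Sum>d\<in>UNIV. matrix_inv (G y) $ a $ d * partial d u y)" for a y
  have \<Gamma>: "christoffel ?G a b c z = christoffel G a b c z + (if a = c then partial b u z else 0)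
      + (if a = b then partial c u z else 0) - G z $ b $ c * U a z" if "z \<in> S" for a b c z
    using christoffel_conformal[OF that du[OF that]] by (simp add: U_def)
  have dU: "U a differentiable at y" for a
    unfolding U_def using y by (intro differentiable_sum differentiable_mult diff_inv ddu ballI) auto
  have pU: "partial e (U a) y = (\<Sum>d\<in>UNIV. partial e (\<lambda>y. matrix_inv (G y) $ a $ d) y * partial d u y
     + matrix_inv (G y) $ a $ d * partial e (partial d u) y)" for e a
    unfolding U_def using y by (simp add: partial_sum partial_mult diff_inv ddu)
  have p\<Gamma>: "partial e (christoffel ?G a b c) y = partial e (christoffel G a b c) y
      + (if a = c then partial e (partial b u) y else 0)
      + (if a = b then partial e (partial c u) y else 0)
      - (partial e (\<lambda>y. G y $ b $ c) y * U a y + G y $ b $ c * partial e (U a) y)" for e a b c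
  proof -
    have "partial e (christoffel ?G a b c) y = partial e (\<lambda>z. christoffel G a b c z + (if a = c then partial b u z else 0)
      + (if a = b then partial c u z else 0) - G z $ b $ c * U a z) y"
      by (intro partial_cong[OF open_S y] \<Gamma>)
    then show ?thesis
      using y by (cases "a = c"; cases "a = b")
        (simp_all add: partial_add partial_diff partial_mult diff dU diff_christoffel ddu)
  qed
  note inv' = symmetric_matrix_inv_mult_2[OF sym[OF y] inv[OF y]]
  \<comment> \<open>First derivatives of the metric and its inverse are expressed by Christoffel
    symbols, and symmetric components get one common name. What remains is a polynomial identity
    modulo \<open>inv'\<close>.\<close>
  note red = ricci_def riemann_def sum_2 \<Gamma>[OF y] p\<Gamma> pU U_def partial_metric[OF y] partial_matrix_inv_christoffel[OF y]
    sym_nth[OF y, of 2 1] sym_inv[OF y, of 2 1] christoffel_sym[OF y, of _ 2 1] partial_christoffel_sym[OF y, of _ _ 2 1]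
    commute[of 2 1]
  have ne: "(1::2) \<noteq> 2" "(2::2) \<noteq> 1" by simp_all
  have b: "b = 1 \<or> b = 2" and d: "d = 1 \<or> d = 2"
    by (simp_all only: exhaust_2)
  then show ?thesis
  proof (elim disjE; hypsubst)
    show "?P 1 1" by (simp only: red ne simp_thms if_True if_False) (use inv' in algebra)
    show "?P 1 2" by (simp only: red ne simp_thms if_True if_False) (use inv' in algebra)
    show "?P 2 1" by (simp only: red ne simp_thms if_True if_False) (use inv' in algebra)
    show "?P 2 2" by (simp only: red ne simp_thms if_True if_False) (use inv' in algebra)
  qed
qed

end

section \<open>The metric of a graph\<close>

text \<open>The inverse of a rank-one update. Multiplying out, the terms in \<open>v i * P j\<close>
  carry the factor 1 - 1/r - (r - 1)/r = 0. For a graph, \<open>A\<close> is \<open>g0\<close>,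
  \<open>v\<close> the gradient of \<open>\<phi>\<close> and \<open>r\<close> the function
  \<open>\<rho>\<close>.\<close>

lemma sherman_morrison:
  fixes A :: "real^'n::finite^'n" and v :: "'n \<Rightarrow> real" and c :: real
  assumes A: "transpose A = A" "invertible A"
  defines "P \<equiv> \<lambda>a. \<Sum>b\<in>UNIV. matrix_inv A $ a $ b * v b"
  defines "r \<equiv> 1 + c * (\<Sum>a\<in>UNIV. P a * v a)"
  assumes r: "r \<noteq> 0"
  shows "invertible (\<chi> i j. A $ i $ j + c * v i * v j)"
    and "matrix_inv (\<chi> i j. A $ i $ j + c * v i * v j) $ a $ b = matrix_inv A $ a $ b - c * P a * P b / r"
proof -
  have AP: "(\<Sum>b\<in>UNIV. A $ a $ b * P b) = v a" for a
    unfolding P_def by (rule sum_matrix_inv_cancel(1)[OF A(2)])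
  have vX: "(\<Sum>b\<in>UNIV. v b * matrix_inv A $ b $ a) = P a" for a
    unfolding P_def using matrix_inv_symmetric[OF A] by (intro sum.cong) auto
  have vP: "c * (\<Sum>b\<in>UNIV. v b * P b) = r - 1"
    by (simp add: r_def mult.commute)
  have "(\<Sum>b\<in>UNIV. (A $ i $ b + c * v i * v b) * (matrix_inv A $ b $ j - c * P b * P j / r))
      = (if i = j then 1 else 0)" for i j
  proof -
    have "(\<Sum>b\<in>UNIV. (A $ i $ b + c * v i * v b) * (matrix_inv A $ b $ j - c * P b * P j / r))
       = (\<Sum>b\<in>UNIV. A $ i $ b * matrix_inv A $ b $ j) - (\<Sum>b\<in>UNIV. A $ i $ b * P b) * (c * P j / r)
         + c * v i * (\<Sum>b\<in>UNIV. v b * matrix_inv A $ b $ j)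
         - v i * (c * P j / r) * (c * (\<Sum>b\<in>UNIV. v b * P b))"
      unfolding sum_distrib_left sum_distrib_right sum.distrib[symmetric] sum_subtractf[symmetric]
      by (intro sum.cong) (auto simp: algebra_simps)
    also have "\<dots> = (if i = j then 1 else 0) - v i * (c * P j / r) + c * v i * P j - v i * (c * P j / r) * (r - 1)"
      unfolding AP vX vP sum_matrix_inv_mult(1)[OF A(2)] by simp
    also have "\<dots> = (if i = j then 1 else 0)"
      using r by (simp add: field_simps)
    finally show ?thesis .
  qed
  then have *: "(\<chi> i j. A $ i $ j + c * v i * v j) ** (\<chi> i j. matrix_inv A $ i $ j - c * P i * P j / r) = mat 1"
    by (simp add: matrix_matrix_mult_def mat_def vec_eq_iff)
  then show "invertible (\<chi> i j. A $ i $ j + c * v i * v j)"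
    unfolding invertible_right_inverse by blast
  show "matrix_inv (\<chi> i j. A $ i $ j + c * v i * v j) $ a $ b = matrix_inv A $ a $ b - c * P a * P b / r"
    unfolding matrix_inv_eqI[OF *] by simp
qed

section \<open>The graph metric: inverse, Christoffel symbols and their derivatives\<close>

locale graph_metric =
  fixes \<epsilon> :: real and g0 :: "real^'n::finite^'n" and \<phi> :: "real^'n \<Rightarrow> real" and U :: "(real^'n) set"
    and \<rho> :: "real^'n \<Rightarrow> real" and h :: "'n metric"
  assumes g0: "transpose g0 = g0" "invertible g0"
    and open_U: "open U" and smooth: "smooth_on U \<phi>"
    and rho: "\<rho> = (\<lambda>x. 1 + \<epsilon> * (\<Sum>\<mu>\<in>UNIV. \<Sum>\<nu>\<in>UNIV.
                 matrix_inv g0 $ \<mu> $ \<nu> * partial \<mu> \<phi> x * partial \<nu> \<phi> x))"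
    and rho_pos: "\<And>x. x \<in> U \<Longrightarrow> \<rho> x > 0"
    and h: "h = (\<lambda>x. \<chi> \<mu> \<nu>. g0 $ \<mu> $ \<nu> + \<epsilon> * partial \<mu> \<phi> x * partial \<nu> \<phi> x)"
begin

definition P :: "'n \<Rightarrow> real^'n \<Rightarrow> real" where
  "P a x = (\<Sum>b\<in>UNIV. matrix_inv g0 $ a $ b * partial b \<phi> x)"

definition w :: "'n \<Rightarrow> real^'n \<Rightarrow> real" where
  "w a x = (\<Sum>d\<in>UNIV. P d x * partial a (partial d \<phi>) x)"

lemma rho_eq: "\<rho> x = 1 + \<epsilon> * (\<Sum>a\<in>UNIV. P a x * partial a \<phi> x)"
  unfolding rho P_def sum_distrib_right
  by (subst sum.swap) (simp add: matrix_inv_symmetric[OF g0] mult_ac)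

lemma diff_partial: "x \<in> U \<Longrightarrow> partial a \<phi> differentiable at x"
  by (intro smooth_on_imp_differentiable[OF open_U] smooth_on_partial smooth)

lemma diff_partial2: "x \<in> U \<Longrightarrow> partial a (partial b \<phi>) differentiable at x"
  by (intro smooth_on_imp_differentiable[OF open_U] smooth_on_partial smooth)

lemma partial2_commute: "x \<in> U \<Longrightarrow> partial a (partial b \<phi>) x = partial b (partial a \<phi>) x"
  by (intro smooth_on_partial_commute[OF open_U smooth])

text \<open>The first exchange is symmetry of second derivatives for
  \<open>partial c \<phi>\<close>; the second differentiates the symmetry for \<open>\<phi>\<close>,
  valid on all of \<open>U\<close>. Together they give full symmetry.\<close>

lemma partial3_commute:
  assumes "x \<in> U"
  shows "partial a (partial b (partial c \<phi>)) x = partial b (partial a (partial c \<phi>)) x"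
    and "partial a (partial b (partial c \<phi>)) x = partial a (partial c (partial b \<phi>)) x"
  using assms smooth_on_partial_commute[OF open_U smooth_on_partial[OF smooth]]
    partial_cong[OF open_U assms partial2_commute] by auto

lemma diff_P: "x \<in> U \<Longrightarrow> P a differentiable at x"
  unfolding P_def by (intro differentiable_sum differentiable_mult differentiable_const diff_partial ballI) auto

lemma partial_P: "x \<in> U \<Longrightarrow> partial e (P a) x = (\<Sum>b\<in>UNIV. matrix_inv g0 $ a $ b * partial e (partial b \<phi>) x)"
  unfolding P_def by (simp add: partial_sum partial_mult diff_partial)

lemma diff_rho: "x \<in> U \<Longrightarrow> \<rho> differentiable at x"
  unfolding rho
  by (intro differentiable_sum differentiable_add differentiable_mult differentiable_const diff_partial ballI) auto

text \<open>As \<open>g0\<close> is symmetric, the derivative contributes equally through either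
  factor, so \<open>w\<close> is half the gradient of the squared length of the gradient of
  \<open>\<phi>\<close>.\<close>

lemma partial_rho:
  assumes x: "x \<in> U"
  shows "partial e \<rho> x = 2 * \<epsilon> * w e x"
proof -
  have "partial e \<rho> x = \<epsilon> * (\<Sum>a\<in>UNIV. \<Sum>b\<in>UNIV. matrix_inv g0 $ a $ b *
      (partial e (partial a \<phi>) x * partial b \<phi> x + partial a \<phi> x * partial e (partial b \<phi>) x))"
    unfolding rho using x
    by (simp add: partial_sum partial_mult partial_add diff_partial algebra_simps)
  also have "(\<Sum>a\<in>UNIV. \<Sum>b\<in>UNIV. matrix_inv g0 $ a $ b *
      (partial e (partial a \<phi>) x * partial b \<phi> x + partial a \<phi> x * partial e (partial b \<phi>) x))
    = w e x + w e x"
    unfolding distrib_left sum.distrib w_def P_def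
    by (rule arg_cong2[of _ _ _ _ "(+)"])
      (simp add: sum_distrib_left sum_distrib_right mult_ac,
       subst sum.swap, simp add: sum_distrib_left sum_distrib_right matrix_inv_symmetric[OF g0] mult_ac)
  finally show ?thesis by simp
qed

lemma rho_ne: "x \<in> U \<Longrightarrow> \<rho> x \<noteq> 0"
  using rho_pos by force

lemma h_inv: "x \<in> U \<Longrightarrow> matrix_inv (h x) $ a $ b = matrix_inv g0 $ a $ b - \<epsilon> * P a x * P b x / \<rho> x"
  using sherman_morrison(2)[OF g0, of \<epsilon> "\<lambda>a. partial a \<phi> x"] rho_ne[of x]
  by (simp add: h rho_eq P_def)

lemma h_invertible: "x \<in> U \<Longrightarrow> invertible (h x)"
  using sherman_morrison(1)[OF g0, of \<epsilon> "\<lambda>a. partial a \<phi> x"] rho_ne[of x]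
  by (simp add: h rho_eq P_def)

lemma diff_h: "x \<in> U \<Longrightarrow> (\<lambda>y. h y $ a $ b) differentiable at x"
  by (simp add: h diff_partial)

lemma partial_h:
  "x \<in> U \<Longrightarrow> partial e (\<lambda>y. h y $ a $ b) x
    = \<epsilon> * (partial e (partial a \<phi>) x * partial b \<phi> x + partial a \<phi> x * partial e (partial b \<phi>) x)"
  by (simp add: h partial_mult partial_add diff_partial algebra_simps)

lemma diff_h_inv:
  assumes x: "x \<in> U"
  shows "(\<lambda>y. matrix_inv (h y) $ a $ b) differentiable at x"
proof -
  have "(\<lambda>y. matrix_inv g0 $ a $ b - \<epsilon> * P a y * P b y / \<rho> y) differentiable at x"
    using x by (intro differentiable_diff differentiable_divide differentiable_mult
        differentiable_const diff_P diff_rho rho_ne)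
  then show ?thesis
    using open_U x by (rule differentiable_transform_open) (simp add: h_inv)
qed

sublocale metric_on U h
proof
  show "transpose (h y) = h y" for y
    using symmetric_nth[OF g0(1)] by (auto simp: h transpose_def vec_eq_iff)
qed (use open_U h_invertible diff_h diff_h_inv in auto)

text \<open>Raising the gradient with \<open>h\<close> instead of \<open>g0\<close> only divides it
  by \<open>\<rho>\<close>, because 1 - (\<rho> - 1)/\<rho> = 1/\<rho>.\<close>

lemma h_inv_gradient:
  assumes x: "x \<in> U"
  shows "(\<Sum>d\<in>UNIV. matrix_inv (h x) $ a $ d * partial d \<phi> x) = P a x / \<rho> x"
proof -
  have "(\<Sum>d\<in>UNIV. matrix_inv (h x) $ a $ d * partial d \<phi> x)
     = P a x - P a x / \<rho> x * (\<epsilon> * (\<Sum>d\<in>UNIV. P d x * partial d \<phi> x))"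
    unfolding h_inv[OF x] left_diff_distrib sum_subtractf P_def[of a, symmetric] sum_distrib_left
    by (simp add: mult_ac)
  also have "\<epsilon> * (\<Sum>d\<in>UNIV. P d x * partial d \<phi> x) = \<rho> x - 1"
    by (simp add: rho_eq)
  finally show ?thesis
    using rho_ne[OF x] by (simp add: field_simps)
qed

text \<open>Of the six terms in the lowered symbol four cancel, leaving a multiple of the gradient
  of \<open>\<phi>\<close>, which is then raised by \<open>h_inv_gradient\<close>.\<close>

lemma christoffel_h:
  assumes x: "x \<in> U"
  shows "christoffel h a b c x = \<epsilon> * P a x * partial b (partial c \<phi>) x / \<rho> x"
proof -
  have "partial b (\<lambda>y. h y $ d $ c) x + partial c (\<lambda>y. h y $ d $ b) x - partial d (\<lambda>y. h y $ b $ c) x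
      = partial d \<phi> x * (2 * \<epsilon> * partial b (partial c \<phi>) x)" for d
    unfolding partial_h[OF x] partial2_commute[OF x, of c b] partial2_commute[OF x, of d b]
      partial2_commute[OF x, of d c] by algebra
  then show ?thesis
    unfolding christoffel_def using h_inv_gradient[OF x, of a]
    by (simp add: mult.assoc[symmetric] flip: sum_distrib_right)
qed

lemma diff_christoffel_h:
  assumes x: "x \<in> U"
  shows "christoffel h a b c differentiable at x"
proof -
  have "(\<lambda>x. \<epsilon> * P a x * partial b (partial c \<phi>) x / \<rho> x) differentiable at x"
    using x by (intro differentiable_divide differentiable_mult
        differentiable_const diff_P diff_rho diff_partial2 rho_ne)
  then show ?thesis
    using open_U x by (rule differentiable_transform_open) (simp add: christoffel_h)
qed

lemma partial_christoffel_h: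
  assumes x: "x \<in> U"
  shows "partial e (christoffel h a b c) x
    = \<epsilon> * (partial e (P a) x * partial b (partial c \<phi>) x + P a x * partial e (partial b (partial c \<phi>)) x) / \<rho> x
      - 2 * \<epsilon>\<^sup>2 * P a x * partial b (partial c \<phi>) x * w e x / (\<rho> x)\<^sup>2"
proof -
  have "partial e (christoffel h a b c) x = partial e (\<lambda>x. \<epsilon> * P a x * partial b (partial c \<phi>) x / \<rho> x) x"
    by (intro partial_cong[OF open_U x] christoffel_h)
  also have "\<dots> = (\<epsilon> * partial e (P a) x * partial b (partial c \<phi>) x + \<epsilon> * P a x * partial e (partial b (partial c \<phi>)) x) / \<rho> x
     - \<epsilon> * P a x * partial b (partial c \<phi>) x * (2 * \<epsilon> * w e x) / (\<rho> x)\<^sup>2"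
    using x by (simp add: partial_divide partial_mult diff_P diff_rho diff_partial2 rho_ne partial_rho)
  finally show ?thesis
    by (simp add: power2_eq_square algebra_simps)
qed

end

section \<open>Curvature of a two-dimensional graph\<close>

locale graph_metric2 = graph_metric \<epsilon> g0 \<phi> U \<rho> h
  for \<epsilon> g0 \<phi> U \<rho> and h :: "2 metric" +
  assumes eps: "\<epsilon>\<^sup>2 = 1"
begin

sublocale metric2_on U h
  by unfold_locales (rule diff_christoffel_h)

text \<open>The Gaussian curvature of \<open>h\<close>. The last factor is the determinant of the
  inverse matrix, kept polynomial in its entries to suit \<open>algebra\<close>.\<close>

definition K :: "real^2 \<Rightarrow> real" where
  "K x = \<epsilon> / \<rho> x * (partial 1 (partial 1 \<phi>) x * partial 2 (partial 2 \<phi>) x - (partial 1 (partial 2 \<phi>) x)\<^sup>2)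
    * (matrix_inv (h x) $ 1 $ 1 * matrix_inv (h x) $ 2 $ 2 - (matrix_inv (h x) $ 1 $ 2)\<^sup>2)"

text \<open>Third derivatives of \<open>\<phi>\<close> cancel by symmetry. The terms quadratic in
  \<open>P\<close> are exactly those that turn \<open>matrix_inv g0\<close> into
  \<open>matrix_inv (h x)\<close>.\<close>

lemma gauss_equation:
  assumes x: "x \<in> U"
  shows "ricci h b d x = \<epsilon> / \<rho> x * (\<Sum>a\<in>UNIV. \<Sum>m\<in>UNIV. matrix_inv (h x) $ a $ m *
    (partial a (partial m \<phi>) x * partial b (partial d \<phi>) x - partial m (partial b \<phi>) x * partial a (partial d \<phi>) x))"
    (is "?P b d")
proof -
  note red = ricci_def riemann_def sum_2 christoffel_h[OF x] partial_christoffel_h[OF x]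
    partial_P[OF x] w_def matrix_inv_symmetric[OF g0, of 2 1] h_inv[OF x]
    partial2_commute[OF x, of 2 1] partial3_commute[OF x, of 2 1] partial3_commute(2)[OF x, of _ 2 1]
    divide_inverse power_inverse[symmetric]
  have "b = 1 \<or> b = 2" and "d = 1 \<or> d = 2"
    by (simp_all only: exhaust_2)
  then show ?thesis
  proof (elim disjE; hypsubst)
    show "?P 1 1" by (simp only: red) algebra
    show "?P 1 2" by (simp only: red) algebra
    show "?P 2 1" by (simp only: red) algebra
    show "?P 2 2" by (simp only: red) algebra
  qed
qed

lemmas h_h_inv = symmetric_matrix_inv_mult_2[OF sym inv]

text \<open>Write B for the Hessian of \<open>\<phi>\<close> and X for the inverse of
  \<open>h\<close>. Cayley-Hamilton for XB gives tr(XB) B - BXB = det(XB) h.\<close>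

lemma ricci_h:
  assumes x: "x \<in> U"
  shows "ricci h b d x = K x * h x $ b $ d" (is "?P b d")
proof -
  note red = gauss_equation[OF x] K_def sum_2
    partial2_commute[OF x, of 2 1] sym_nth[OF x, of 2 1] sym_inv[OF x, of 2 1]
  note rel = h_h_inv[OF x x]
  have "b = 1 \<or> b = 2" and "d = 1 \<or> d = 2"
    by (simp_all only: exhaust_2)
  then show ?thesis
  proof (elim disjE; hypsubst)
    show "?P 1 1" by (simp only: red) (use rel in algebra)
    show "?P 1 2" by (simp only: red) (use rel in algebra)
    show "?P 2 1" by (simp only: red) (use rel in algebra)
    show "?P 2 2" by (simp only: red) (use rel in algebra)
  qed
qed

end

section \<open>Minimal graphs\<close>

context graph_metric
begin

lemma diff_w: "x \<in> U \<Longrightarrow> w a differentiable at x"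
  unfolding w_def by (intro differentiable_sum differentiable_mult diff_P diff_partial2 ballI) auto

lemma partial_w: "x \<in> U \<Longrightarrow> partial e (w a) x = (\<Sum>d\<in>UNIV. partial e (P d) x * partial a (partial d \<phi>) x
    + P d x * partial e (partial a (partial d \<phi>)) x)"
  unfolding w_def by (simp add: partial_sum partial_mult diff_P diff_partial2)

definition psi :: "real^'n \<Rightarrow> real" where
  "psi x = - (1/4) * ln (\<rho> x)"

lemma exp_psi: "x \<in> U \<Longrightarrow> exp (2 * psi x) = \<rho> x powr (-1/2)"
  and exp_psi_inverse: "x \<in> U \<Longrightarrow> exp (- (2 * psi x)) = sqrt (\<rho> x)"
  using rho_pos[of x] by (auto simp: psi_def powr_def powr_half_sqrt[symmetric])

lemma has_real_derivative_psi:
  "x \<in> U \<Longrightarrow> ((\<lambda>t. - (1/4) * ln t) has_real_derivative - (1 / (4 * \<rho> x))) (at (\<rho> x))"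
  using rho_pos[of x] by (auto intro!: derivative_eq_intros)

lemma diff_psi: "x \<in> U \<Longrightarrow> psi differentiable at x"
  using partial_compose_real(2)[OF diff_rho has_real_derivative_psi] unfolding psi_def .

lemma partial_psi: "x \<in> U \<Longrightarrow> partial a psi x = - \<epsilon> / 2 * (w a x / \<rho> x)"
  using partial_compose_real(1)[OF diff_rho has_real_derivative_psi] unfolding psi_def
  by (simp add: partial_rho field_simps)

lemma diff_partial_psi:
  assumes x: "x \<in> U"
  shows "partial a psi differentiable at x"
proof -
  have "(\<lambda>y. - \<epsilon> / 2 * (w a y / \<rho> y)) differentiable at x"
    using x by (intro differentiable_mult differentiable_divide differentiable_const diff_w diff_rho rho_ne)
  then show ?thesis
    using open_U x by (rule differentiable_transform_open) (simp add: partial_psi)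
qed

lemma partial2_psi:
  assumes x: "x \<in> U"
  shows "partial a (partial c psi) x
    = - \<epsilon> / 2 * (partial a (w c) x / \<rho> x - 2 * \<epsilon> * w a x * w c x / (\<rho> x)\<^sup>2)"
proof -
  have "partial a (partial c psi) x = partial a (\<lambda>y. - \<epsilon> / 2 * (w c y / \<rho> y)) x"
    by (intro partial_cong[OF open_U x] partial_psi)
  also have "\<dots> = - \<epsilon> / 2 * partial a (\<lambda>y. w c y / \<rho> y) x"
    using x by (subst partial_mult)
      (auto intro!: differentiable_divide diff_w diff_rho simp: rho_ne simp del: times_divide_eq_right)
  finally show ?thesis
    using x by (simp add: partial_divide diff_w diff_rho rho_ne partial_rho mult_ac)
qed

text \<open>Expected since \<open>w\<close> is a gradient up to a constant; it supplies the
  symmetric second derivatives of \<open>psi\<close> that \<open>ricci_conformal\<close> asks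
  for.\<close>

lemma partial_w_commute:
  assumes x: "x \<in> U"
  shows "partial a (w c) x = partial c (w a) x"
proof -
  have "(\<Sum>d\<in>UNIV. partial a (P d) x * partial c (partial d \<phi>) x)
      = (\<Sum>d\<in>UNIV. partial c (P d) x * partial a (partial d \<phi>) x)"
    unfolding partial_P[OF x] sum_distrib_right
    by (subst sum.swap) (simp add: matrix_inv_symmetric[OF g0] mult_ac)
  then show ?thesis
    using x by (simp add: partial_w sum.distrib partial3_commute(1)[OF x, of a c])
qed

lemma partial2_psi_commute: "x \<in> U \<Longrightarrow> partial a (partial c psi) x = partial c (partial a psi) x"
  by (simp add: partial2_psi partial_w_commute[of x a c] mult_ac)

lemma h_P:
  assumes x: "x \<in> U"
  shows "(\<Sum>b\<in>UNIV. h x $ a $ b * P b x) = \<rho> x * partial a \<phi> x"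
proof -
  have "(\<Sum>b\<in>UNIV. h x $ a $ b * P b x)
      = \<rho> x * (\<Sum>b\<in>UNIV. h x $ a $ b * (\<Sum>d\<in>UNIV. matrix_inv (h x) $ b $ d * partial d \<phi> x))"
    unfolding h_inv_gradient[OF x] sum_distrib_left using rho_ne[OF x] by simp
  then show ?thesis
    using sum_matrix_inv_cancel(1)[OF inv[OF x]] by simp
qed

end

lemma (in graph_metric2) rho_K:
  assumes x: "x \<in> U"
  shows "\<rho> x * K x = \<epsilon>
    * (partial 1 (partial 1 \<phi>) x * partial 2 (partial 2 \<phi>) x - (partial 1 (partial 2 \<phi>) x)\<^sup>2)
    * (matrix_inv (h x) $ 1 $ 1 * matrix_inv (h x) $ 2 $ 2 - (matrix_inv (h x) $ 1 $ 2)\<^sup>2)"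
  using rho_ne[OF x] by (simp add: K_def)

section \<open>Consequences of the minimal surface equation\<close>

locale minimal_graph2 = graph_metric2 +
  assumes minimal: "\<And>x. x \<in> U \<Longrightarrow>
    (\<Sum>\<mu>\<in>UNIV. \<Sum>\<nu>\<in>UNIV. matrix_inv (h x) $ \<mu> $ \<nu> * partial \<mu> (partial \<nu> \<phi>) x) = 0"
begin

lemma minimal':
  assumes x: "x \<in> U"
  shows "matrix_inv (h x) $ 1 $ 1 * partial 1 (partial 1 \<phi>) x
    + 2 * (matrix_inv (h x) $ 1 $ 2 * partial 1 (partial 2 \<phi>) x)
    + matrix_inv (h x) $ 2 $ 2 * partial 2 (partial 2 \<phi>) x = 0"
  using minimal[OF x] unfolding sum_2 partial2_commute[OF x, of 2 1] sym_inv[OF x, of 2 1]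
  by algebra

text \<open>With B the Hessian and X the inverse of \<open>h\<close>, minimality reads tr(XB) = 0,
  so BXB = - det(XB) h by Cayley-Hamilton. Since \<open>w\<close> is B applied to \<open>P\<close>,
  this leaves the \<open>h\<close>-square of \<open>P\<close>, known from
  \<open>h_P\<close>.\<close>

lemma norm_w:
  assumes x: "x \<in> U"
  shows "(\<Sum>a\<in>UNIV. \<Sum>b\<in>UNIV. matrix_inv (h x) $ a $ b * (w a x * w b x)) = - (\<rho> x)\<^sup>2 * (\<rho> x - 1) * K x"
proof -
  let ?D = "partial 1 (partial 1 \<phi>) x * partial 2 (partial 2 \<phi>) x - (partial 1 (partial 2 \<phi>) x)\<^sup>2"
  let ?H = "matrix_inv (h x) $ 1 $ 1 * matrix_inv (h x) $ 2 $ 2 - (matrix_inv (h x) $ 1 $ 2)\<^sup>2"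
  have "(\<Sum>a\<in>UNIV. \<Sum>b\<in>UNIV. matrix_inv (h x) $ a $ b * (w a x * w b x))
     = - ?D * ?H * (\<Sum>a\<in>UNIV. \<Sum>b\<in>UNIV. h x $ a $ b * P a x * P b x)"
    using h_h_inv[OF x x] minimal'[OF x]
    unfolding sum_2 w_def partial2_commute[OF x, of 2 1] sym_nth[OF x, of 2 1] sym_inv[OF x, of 2 1]
    by algebra
  also have "(\<Sum>a\<in>UNIV. \<Sum>b\<in>UNIV. h x $ a $ b * P a x * P b x)
      = \<rho> x * (\<Sum>a\<in>UNIV. P a x * partial a \<phi> x)"
    using h_P[OF x, of 1] h_P[OF x, of 2] unfolding sum_2 by algebra
  finally have "(\<Sum>a\<in>UNIV. \<Sum>b\<in>UNIV. matrix_inv (h x) $ a $ b * (w a x * w b x))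
     = - ?D * ?H * \<rho> x * (\<Sum>a\<in>UNIV. P a x * partial a \<phi> x)" by simp
  \<comment> \<open>As \<open>\<epsilon>\<close> is its own inverse, the pairing of \<open>P\<close>
    with the gradient equals \<epsilon> (\<rho> - 1).\<close>
  also have "\<dots> = - ?D * ?H * \<rho> x * \<epsilon> * (\<rho> x - 1)"
    using eps unfolding rho_eq by algebra
  also have "\<dots> = - (\<rho> x)\<^sup>2 * (\<rho> x - 1) * K x"
    using rho_K[OF x] by algebra
  finally show ?thesis .
qed

text \<open>Minimality holds on the open set \<open>U\<close>, so it may be differentiated. The
  derivative of the inverse metric is quadratic in known quantities, which trades traced third
  derivatives for second ones.\<close>

lemma minimal_derivative:
  assumes x: "x \<in> U"
  shows "(\<Sum>a\<in>UNIV. \<Sum>b\<in>UNIV. matrix_inv (h x) $ a $ b * partial d (partial a (partial b \<phi>)) x)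
    = 2 * \<epsilon> / \<rho> x * (\<Sum>a\<in>UNIV. \<Sum>b\<in>UNIV. matrix_inv (h x) $ a $ b * (w a x * partial b (partial d \<phi>) x))"
proof -
  have "0 = partial d (\<lambda>y. \<Sum>a\<in>UNIV. \<Sum>b\<in>UNIV. matrix_inv (h y) $ a $ b * partial a (partial b \<phi>) y) x"
    using partial_cong[OF open_U x minimal, where i = d] by simp
  also have "\<dots> = (\<Sum>a\<in>UNIV. \<Sum>b\<in>UNIV. partial d (\<lambda>y. matrix_inv (h y) $ a $ b) x * partial a (partial b \<phi>) x
      + matrix_inv (h x) $ a $ b * partial d (partial a (partial b \<phi>)) x)"
    using x by (simp add: partial_sum partial_mult diff_inv diff_partial2)
  finally show ?thesis
    unfolding sum_2 partial_matrix_inv_christoffel[OF x] christoffel_h[OF x] w_def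
      partial2_commute[OF x, of _ d] sym_inv[OF x, of 2 1] divide_inverse
      partial2_commute[OF x, of 2 1]
    by algebra
qed

text \<open>A derivative of \<open>w\<close> falls on \<open>P\<close> or on the Hessian of
  \<open>\<phi>\<close>. The first part gives - 2 det(XB) plus one multiple of \<open>?N\<close>,
  the second two more multiples through \<open>minimal_derivative\<close>; \<open>norm_w\<close>
  evaluates \<open>?N\<close>.\<close>

lemma trace_partial_w:
  assumes x: "x \<in> U"
  shows "(\<Sum>a\<in>UNIV. \<Sum>c\<in>UNIV. matrix_inv (h x) $ a $ c * partial a (w c) x)
    = - 2 * \<epsilon> * \<rho> x * K x - 3 * \<epsilon> * \<rho> x * (\<rho> x - 1) * K x"
proof -
  let ?X = "\<lambda>a c. matrix_inv (h x) $ a $ c"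
  let ?D = "partial 1 (partial 1 \<phi>) x * partial 2 (partial 2 \<phi>) x - (partial 1 (partial 2 \<phi>) x)\<^sup>2"
  let ?H = "?X 1 1 * ?X 2 2 - (?X 1 2)\<^sup>2"
  let ?N = "\<Sum>a\<in>UNIV. \<Sum>b\<in>UNIV. ?X a b * (w a x * w b x)"
  \<comment> \<open>\<open>h_inv\<close> solved for the flat inverse, so that only contractions with
    \<open>?X\<close> remain, where minimality applies.\<close>
  have k: "matrix_inv g0 $ a $ b = ?X a b + \<epsilon> * P a x * P b x * inverse (\<rho> x)" for a b
    by (simp add: h_inv[OF x] divide_inverse)
  have "(\<Sum>a\<in>UNIV. \<Sum>c\<in>UNIV. ?X a c * (\<Sum>d\<in>UNIV. partial a (P d) x * partial c (partial d \<phi>) x))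
     = - 2 * (?D * ?H) + \<epsilon> * inverse (\<rho> x) * ?N"
    using minimal'[OF x]
    unfolding sum_2 partial_P[OF x] k w_def partial2_commute[OF x, of 2 1] sym_inv[OF x, of 2 1]
    by algebra
  moreover have "(\<Sum>a\<in>UNIV. \<Sum>c\<in>UNIV. ?X a c * (\<Sum>d\<in>UNIV. P d x * partial a (partial c (partial d \<phi>)) x))
     = (\<Sum>d\<in>UNIV. P d x * (\<Sum>a\<in>UNIV. \<Sum>c\<in>UNIV. ?X a c * partial d (partial a (partial c \<phi>)) x))"
    unfolding sum_2 sym_inv[OF x, of 2 1] partial3_commute(2)[OF x, of _ 2 1] partial3_commute(1)[OF x, of 2 1]
    by algebra
  moreover have "\<dots> = 2 * \<epsilon> * inverse (\<rho> x) * ?N"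
    unfolding minimal_derivative[OF x]
    unfolding sum_2 w_def partial2_commute[OF x, of 2 1] divide_inverse sym_inv[OF x, of 2 1]
    by algebra
  ultimately have "(\<Sum>a\<in>UNIV. \<Sum>c\<in>UNIV. ?X a c * partial a (w c) x)
      = - 2 * (?D * ?H) + 3 * \<epsilon> * inverse (\<rho> x) * ?N"
    unfolding partial_w[OF x] sum.distrib distrib_left by simp
  also have "?D * ?H = \<epsilon> * \<rho> x * K x"
    using rho_K[OF x] eps by algebra
  finally show ?thesis
    unfolding norm_w[OF x] using rho_ne[OF x] by (simp add: power2_eq_square)
qed

text \<open>The Laplacian of \<open>psi\<close> for \<open>h\<close>, in the very form in which
  \<open>ricci_conformal\<close> produces it.\<close>

definition lap_psi :: "real^2 \<Rightarrow> real" where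
  "lap_psi x = (\<Sum>a\<in>UNIV. \<Sum>c\<in>UNIV. matrix_inv (h x) $ a $ c *
      (partial a (partial c psi) x - (\<Sum>e\<in>UNIV. christoffel h e a c x * partial e psi x)))"

lemma lap_psi_eq:
  assumes x: "x \<in> U"
  shows "lap_psi x = (\<rho> x + 1) / 2 * K x"
proof -
  let ?X = "\<lambda>a c. matrix_inv (h x) $ a $ c"
  \<comment> \<open>The Christoffel symbols are multiples of the Hessian of \<open>\<phi>\<close>,
    so the whole connection term is a multiple of the minimality equation and drops out
    next.\<close>
  have "lap_psi x = - \<epsilon> / 2 * ((\<Sum>a\<in>UNIV. \<Sum>c\<in>UNIV. ?X a c * partial a (w c) x) / \<rho> x
     - 2 * \<epsilon> * (\<Sum>a\<in>UNIV. \<Sum>c\<in>UNIV. ?X a c * (w a x * w c x)) / (\<rho> x)\<^sup>2)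
     - \<epsilon> / \<rho> x * (\<Sum>e\<in>UNIV. P e x * partial e psi x)
       * (\<Sum>a\<in>UNIV. \<Sum>c\<in>UNIV. ?X a c * partial a (partial c \<phi>) x)"
    unfolding lap_psi_def partial2_psi[OF x] christoffel_h[OF x] sum_2
    by (simp add: algebra_simps diff_divide_distrib add_divide_distrib)
  also have "\<dots> = - \<epsilon> / 2 * (- 2 * \<epsilon> * K x - 3 * \<epsilon> * (\<rho> x - 1) * K x + 2 * \<epsilon> * (\<rho> x - 1) * K x)"
    unfolding trace_partial_w[OF x] norm_w[OF x] minimal[OF x]
    using rho_ne[OF x] by (simp add: field_simps power2_eq_square)
  also have "\<dots> = \<epsilon>\<^sup>2 * ((\<rho> x + 1) / 2 * K x)"
    by (simp add: field_simps power2_eq_square)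
  finally show ?thesis by (simp add: eps)
qed

end

section \<open>The conformal metric \<open>g\<close>\<close>

context graph_metric
begin

text \<open>The exponential form matches \<open>ricci_conformal\<close> literally; on
  \<open>U\<close> the factor is \<open>\<rho> x powr (-1/2)\<close> by
  \<open>exp_psi\<close>.\<close>

definition g :: "'n metric" where
  "g y = exp (2 * psi y) *\<^sub>R h y"

lemma g_inv: "x \<in> U \<Longrightarrow> matrix_inv (g x) = exp (- (2 * psi x)) *\<^sub>R matrix_inv (h x)"
  unfolding g_def by (simp add: matrix_inv_scaleR h_invertible exp_minus)

lemma partial_exp_psi:
  assumes x: "x \<in> U"
  shows "(\<lambda>y. exp (c * psi y)) differentiable at x"
    and "partial a (\<lambda>y. exp (c * psi y)) x = c * exp (c * psi x) * partial a psi x"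
proof -
  have D: "((\<lambda>t. exp (c * t)) has_real_derivative c * exp (c * psi x)) (at (psi x))"
    by (auto intro!: derivative_eq_intros)
  show "(\<lambda>y. exp (c * psi y)) differentiable at x"
    and "partial a (\<lambda>y. exp (c * psi y)) x = c * exp (c * psi x) * partial a psi x"
    using partial_compose_real[OF diff_psi[OF x] D] by auto
qed

lemma partial_g:
  assumes x: "x \<in> U"
  shows "partial a g x $ i $ j
    = exp (2 * psi x) * (partial a (\<lambda>y. h y $ i $ j) x + 2 * partial a psi x * h x $ i $ j)"
proof -
  have "(\<lambda>y. g y $ i $ j) differentiable at x" for i j
    using x by (simp add: g_def partial_exp_psi diff_h)
  then have "partial a g x $ i $ j = partial a (\<lambda>y. exp (2 * psi y) * h y $ i $ j) x"
    by (simp add: partial_nth_nth g_def)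
  then show ?thesis
    unfolding partial_mult[OF partial_exp_psi(1)[OF x] diff_h[OF x]] partial_exp_psi(2)[OF x]
    by (simp add: algebra_simps)
qed

lemma partial_g_inv:
  assumes x: "x \<in> U"
  shows "partial a (\<lambda>y. matrix_inv (g y)) x $ i $ j = exp (- (2 * psi x))
    * (partial a (\<lambda>y. matrix_inv (h y) $ i $ j) x - 2 * partial a psi x * matrix_inv (h x) $ i $ j)"
proof -
  note * = partial_exp_psi[OF x, where c = "-2"]
  have eq: "matrix_inv (g y) $ i $ j = exp (-2 * psi y) * matrix_inv (h y) $ i $ j" if "y \<in> U" for y i j
    using g_inv[OF that] by simp
  have "(\<lambda>y. exp (-2 * psi y) * matrix_inv (h y) $ i $ j) differentiable at x" for i j
    using x by (intro differentiable_mult * diff_inv)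
  then have "(\<lambda>y. matrix_inv (g y) $ i $ j) differentiable at x" for i j
    using open_U x by (rule differentiable_transform_open) (simp add: eq)
  then have "partial a (\<lambda>y. matrix_inv (g y)) x $ i $ j = partial a (\<lambda>y. matrix_inv (g y) $ i $ j) x"
    by (rule partial_nth_nth)
  also have "\<dots> = partial a (\<lambda>y. exp (-2 * psi y) * matrix_inv (h y) $ i $ j) x"
    by (intro partial_cong[OF open_U x] eq)
  also have "\<dots> = exp (-2 * psi x)
    * (partial a (\<lambda>y. matrix_inv (h y) $ i $ j) x - 2 * partial a psi x * matrix_inv (h x) $ i $ j)"
    unfolding partial_mult[OF *(1) diff_inv[OF x]] *(2) by algebra
  finally show ?thesis by simp
qed

end

context minimal_graph2
begin

lemma ricci_g:
  assumes x: "x \<in> U"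
  shows "ricci g a b x = ricci h a b x - lap_psi x * h x $ a $ b"
  unfolding lap_psi_def g_def[abs_def]
  by (intro ricci_conformal x diff_psi diff_partial_psi partial2_psi_commute)

lemma ricci_g_eq:
  assumes x: "x \<in> U"
  shows "ricci g a b x = - ((\<rho> x - 1) / 2) * ricci h a b x"
  unfolding ricci_g[OF x] lap_psi_eq[OF x] ricci_h[OF x] by (simp add: field_simps)

lemma trace_h_inv_h:
  assumes x: "x \<in> U"
  shows "(\<Sum>a\<in>UNIV. \<Sum>b\<in>UNIV. matrix_inv (h x) $ a $ b * h x $ a $ b) = 2"
  using h_h_inv[OF x x] unfolding sum_2 sym_nth[OF x, of 2 1] sym_inv[OF x, of 2 1] by algebra

lemma ricci_scalar_h: "x \<in> U \<Longrightarrow> ricci_scalar h x = 2 * K x"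
  using trace_h_inv_h[of x]
  by (simp add: ricci_scalar_def ricci_h mult.left_commute[of _ "K x"] flip: sum_distrib_left)

lemma ricci_scalar_g:
  assumes x: "x \<in> U"
  shows "ricci_scalar g x = - sqrt (\<rho> x) * (\<rho> x - 1) * K x"
proof -
  have "ricci_scalar g x = - sqrt (\<rho> x) * ((\<rho> x - 1) / 2) * K x
    * (\<Sum>a\<in>UNIV. \<Sum>b\<in>UNIV. matrix_inv (h x) $ a $ b * h x $ a $ b)"
    unfolding ricci_scalar_def ricci_g_eq[OF x] ricci_h[OF x] sum_distrib_left
    by (simp add: g_inv[OF x] exp_psi_inverse[OF x] mult_ac)
  then show ?thesis
    unfolding trace_h_inv_h[OF x] by simp
qed

lemma det_h: "det (h x) = det g0 * \<rho> x"
proof -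
  have g12: "g0 $ 2 $ 1 = g0 $ 1 $ 2" by (rule symmetric_nth[OF g0(1)])
  show ?thesis
    using symmetric_matrix_inv_mult_2[OF g0]
    unfolding det_2 rho_eq P_def sum_2 h vec_lambda_beta g12 matrix_inv_symmetric[OF g0, of 2 1]
    by algebra
qed

text \<open>In dimension two the determinant scales by the square of the conformal factor, which is
  1/\<rho> and cancels the \<open>\<rho>\<close> of \<open>det_h\<close>. Hence the density in the
  Laplace-Beltrami operator of \<open>g\<close> is constant.\<close>

lemma det_g:
  assumes x: "x \<in> U"
  shows "det (g x) = det g0"
proof -
  have "exp (2 * psi x) * (exp (2 * psi x) * \<rho> x) = 1"
    using rho_pos[OF x] by (simp add: exp_psi[OF x] powr_minus_divide powr_half_sqrt field_simps)
  moreover have "det (g x) = exp (2 * psi x) * exp (2 * psi x) * det (h x)"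
    by (simp add: g_def det_2 algebra_simps)
  ultimately show ?thesis unfolding det_h by algebra
qed

lemma laplace_beltrami_g:
  assumes x: "x \<in> U"
  shows "laplace_beltrami g psi x = sqrt (\<rho> x) * lap_psi x"
proof -
  let ?X = "\<lambda>a b. matrix_inv (h x) $ a $ b" and ?s = "\<bar>det g0\<bar> powr (1/2)" and ?e = "exp (-2 * psi x)"
  note E = partial_exp_psi[OF x, where c = "-2"]
  have d: "(\<lambda>y. matrix_inv (h y) $ a $ b * partial b psi y) differentiable at x" for a b
    using x by (intro differentiable_mult diff_inv diff_partial_psi)
  have d': "(\<lambda>y. \<Sum>b\<in>UNIV. matrix_inv (h y) $ a $ b * partial b psi y) differentiable at x" for a
    by (intro differentiable_sum ballI d) auto
  have p: "partial a (\<lambda>y. \<bar>det (g y)\<bar> powr (1/2) * (\<Sum>b\<in>UNIV. matrix_inv (g y) $ a $ b * partial b psi y)) x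
     = ?s * ?e * (\<Sum>b\<in>UNIV. - 2 * partial a psi x * (?X a b * partial b psi x)
         + (partial a (\<lambda>y. matrix_inv (h y) $ a $ b) x * partial b psi x + ?X a b * partial a (partial b psi) x))" for a
  proof -
    have "partial a (\<lambda>y. \<bar>det (g y)\<bar> powr (1/2) * (\<Sum>b\<in>UNIV. matrix_inv (g y) $ a $ b * partial b psi y)) x
       = partial a (\<lambda>y. ?s * (exp (-2 * psi y) * (\<Sum>b\<in>UNIV. matrix_inv (h y) $ a $ b * partial b psi y))) x"
      by (intro partial_cong[OF open_U x]) (simp add: det_g g_inv sum_distrib_left mult_ac)
    also have "\<dots> = ?s * (-2 * ?e * partial a psi x * (\<Sum>b\<in>UNIV. ?X a b * partial b psi x)
        + ?e * (\<Sum>b\<in>UNIV. partial a (\<lambda>y. matrix_inv (h y) $ a $ b) x * partial b psi x + ?X a b * partial a (partial b psi) x))"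
      unfolding partial_mult[OF differentiable_const differentiable_mult[OF E(1) d']] partial_const
        partial_mult[OF E(1) d'] E(2) partial_sum[OF d]
        partial_mult[OF diff_inv[OF x] diff_partial_psi[OF x]] by simp
    finally have *: "partial a (\<lambda>y. \<bar>det (g y)\<bar> powr (1/2) * (\<Sum>b\<in>UNIV. matrix_inv (g y) $ a $ b * partial b psi y)) x = \<dots>" .
    show ?thesis
      unfolding * sum.distrib sum_distrib_left[symmetric] by algebra
  qed
  have "\<bar>det g0\<bar> powr (-1/2) * ?s = 1"
    using g0(2) invertible_det_nz[of g0] by (simp add: powr_add[symmetric])
  then have "laplace_beltrami g psi x = ?e * (\<Sum>a\<in>UNIV. \<Sum>b\<in>UNIV. - 2 * partial a psi x * (?X a b * partial b psi x)
         + (partial a (\<lambda>y. matrix_inv (h y) $ a $ b) x * partial b psi x + ?X a b * partial a (partial b psi) x))"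
    unfolding laplace_beltrami_def det_g[OF x] p by (simp flip: sum_distrib_left mult.assoc)
  \<comment> \<open>The contracted symbol with indices a, a, m is \<epsilon> \<open>w m x\<close> /
    \<rho>, that is -2 times the derivative of \<open>psi\<close>. So one half of the derivative of
    the inverse metric cancels the term from the exponential; the other half is the connection
    term.\<close>
  also have "\<dots> = ?e * lap_psi x"
    unfolding lap_psi_def sum_2 partial_matrix_inv_christoffel[OF x] partial_psi[OF x] christoffel_h[OF x]
      w_def partial2_commute[OF x, of 2 1] sym_inv[OF x, of 2 1] divide_inverse
    by algebra
  finally show ?thesis
    using exp_psi_inverse[OF x] by simp
qed

lemma trace_partial_g_inv_partial_g:
  assumes x: "x \<in> U"
  shows "(\<Sum>a\<in>UNIV. \<Sum>b\<in>UNIV. matrix_inv (g x) $ a $ b * trace (partial a (\<lambda>y. matrix_inv (g y)) x ** partial b g x))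
    = 4 * sqrt (\<rho> x) * (\<rho> x - 1) * K x"
proof -
  let ?X = "\<lambda>a b. matrix_inv (h x) $ a $ b" and ?p = "\<lambda>a b. partial a (partial b \<phi>) x"
  let ?r = "inverse (\<rho> x)" and ?N = "\<lambda>a b. \<Sum>m\<in>UNIV. \<Sum>n\<in>UNIV. ?X m n * ?p a m * ?p b n"
  have r: "?r * \<rho> x = 1" using rho_ne[OF x] by simp
  have Xp: "?X 1 1 * partial 1 \<phi> x + ?X 1 2 * partial 2 \<phi> x = P 1 x * ?r"
    "?X 1 2 * partial 1 \<phi> x + ?X 2 2 * partial 2 \<phi> x = P 2 x * ?r"
    using h_inv_gradient[OF x, of 1] h_inv_gradient[OF x, of 2] sym_inv[OF x, of 2 1]
    by (simp_all add: sum_2 divide_inverse)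
  have Pp: "\<epsilon> * (P 1 x * partial 1 \<phi> x + P 2 x * partial 2 \<phi> x) = \<rho> x - 1"
    by (simp add: rho_eq sum_2)
  have "exp (- (2 * psi x)) * exp (2 * psi x) = 1"
    by (simp flip: exp_add)
  then have 1: "trace (partial a (\<lambda>y. matrix_inv (g y)) x ** partial b g x)
     = (\<Sum>c\<in>UNIV. \<Sum>d\<in>UNIV. (partial a (\<lambda>y. matrix_inv (h y) $ c $ d) x - 2 * partial a psi x * ?X c d)
         * (partial b (\<lambda>y. h y $ d $ c) x + 2 * partial b psi x * h x $ d $ c))" for a b
    unfolding trace_def matrix_matrix_mult_def vec_lambda_beta partial_g[OF x] partial_g_inv[OF x] sum_2
    by algebra
  have 2: "(\<Sum>c\<in>UNIV. \<Sum>d\<in>UNIV. partial a (\<lambda>y. matrix_inv (h y) $ c $ d) x * partial b (\<lambda>y. h y $ d $ c) x)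
     = - 2 * \<epsilon>\<^sup>2 * ?r\<^sup>2 * w a x * w b x - 2 * \<epsilon> * (\<rho> x - 1) * ?r * ?N a b" for a b
    using Xp Pp
    unfolding sum_2 partial_matrix_inv_christoffel[OF x] partial_h[OF x] christoffel_h[OF x] w_def
      sym_inv[OF x, of 2 1] divide_inverse
    by algebra
  have 3: "(\<Sum>c\<in>UNIV. \<Sum>d\<in>UNIV. partial a (\<lambda>y. matrix_inv (h y) $ c $ d) x * h x $ d $ c) = - 2 * \<epsilon> * ?r * w a x" for a
    using h_h_inv[OF x x]
    unfolding sum_2 partial_matrix_inv_christoffel[OF x] christoffel_h[OF x] w_def
      sym_inv[OF x, of 2 1] sym_nth[OF x, of 2 1] divide_inverse
    by algebra
  have 4: "(\<Sum>c\<in>UNIV. \<Sum>d\<in>UNIV. ?X c d * partial b (\<lambda>y. h y $ d $ c) x) = 2 * \<epsilon> * ?r * w b x" for b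
    using Xp
    unfolding sum_2 partial_h[OF x] w_def sym_inv[OF x, of 2 1]
    by algebra
  have 5: "(\<Sum>c\<in>UNIV. \<Sum>d\<in>UNIV. ?X c d * h x $ d $ c) = 2"
    using trace_h_inv_h[OF x] unfolding sum_2 sym_inv[OF x, of 2 1] sym_nth[OF x, of 2 1] .
  \<comment> \<open>The four contributions in \<open>w a x * w b x\<close> have relative weights -2,
    2, 2, -2 and cancel; this is special to the exponent in \<open>psi\<close>.\<close>
  have tr: "trace (partial a (\<lambda>y. matrix_inv (g y)) x ** partial b g x) = - 2 * \<epsilon> * (\<rho> x - 1) * ?r * ?N a b" for a b
  proof -
    have "trace (partial a (\<lambda>y. matrix_inv (g y)) x ** partial b g x)
      = (\<Sum>c\<in>UNIV. \<Sum>d\<in>UNIV. partial a (\<lambda>y. matrix_inv (h y) $ c $ d) x * partial b (\<lambda>y. h y $ d $ c) x)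
        + 2 * partial b psi x * (\<Sum>c\<in>UNIV. \<Sum>d\<in>UNIV. partial a (\<lambda>y. matrix_inv (h y) $ c $ d) x * h x $ d $ c)
        - 2 * partial a psi x * (\<Sum>c\<in>UNIV. \<Sum>d\<in>UNIV. ?X c d * partial b (\<lambda>y. h y $ d $ c) x)
        - 4 * partial a psi x * partial b psi x * (\<Sum>c\<in>UNIV. \<Sum>d\<in>UNIV. ?X c d * h x $ d $ c)"
      unfolding 1 sum_2 by algebra
    then show ?thesis
      unfolding 2 3 4 5 partial_psi[OF x] divide_inverse by (simp add: power2_eq_square)
  qed
  \<comment> \<open>The left side is the trace of the square of XB, which equals - 2 det(XB) once XB
    is trace-free.\<close>
  have "(\<Sum>a\<in>UNIV. \<Sum>b\<in>UNIV. ?X a b * ?N a b)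
    = - 2 * ((?p 1 1 * ?p 2 2 - (?p 1 2)\<^sup>2) * (?X 1 1 * ?X 2 2 - (?X 1 2)\<^sup>2))"
    using minimal'[OF x] unfolding sum_2 partial2_commute[OF x, of 2 1] sym_inv[OF x, of 2 1]
    by algebra
  moreover have "(\<Sum>a\<in>UNIV. \<Sum>b\<in>UNIV. matrix_inv (g x) $ a $ b * trace (partial a (\<lambda>y. matrix_inv (g y)) x ** partial b g x))
    = - 2 * \<epsilon> * (\<rho> x - 1) * ?r * sqrt (\<rho> x) * (\<Sum>a\<in>UNIV. \<Sum>b\<in>UNIV. ?X a b * ?N a b)"
    unfolding tr g_inv[OF x] exp_psi_inverse[OF x] sum_2 vector_scaleR_component real_scaleR_def
    by algebra
  ultimately show ?thesis
    using rho_K[OF x] r by algebra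
qed

lemma curvature_identities:
  assumes x: "x \<in> U"
  shows "ricci_scalar g x = - (1/4) * (\<Sum>\<alpha>\<in>UNIV. \<Sum>\<beta>\<in>UNIV. matrix_inv (g x) $ \<alpha> $ \<beta> *
          trace (partial \<alpha> (\<lambda>y. matrix_inv (g y)) x ** partial \<beta> g x))"
    and "ricci_scalar g x = sqrt (\<rho> x) * ricci_scalar h x - 2 * laplace_beltrami g psi x"
  unfolding trace_partial_g_inv_partial_g[OF x] laplace_beltrami_g[OF x] lap_psi_eq[OF x]
    ricci_scalar_g[OF x] ricci_scalar_h[OF x]
  by (simp_all add: field_simps)

end

section \<open>The three curvature identities\<close>

theorem proposition3:
  fixes \<epsilon> :: real and g0 :: "real^2^2" and \<phi> :: "real^2 \<Rightarrow> real" and U :: "(real^2) set"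
    and \<rho> \<psi>0 :: "real^2 \<Rightarrow> real" and h g :: "2 metric"
  assumes "\<epsilon> \<in> {1, -1}"
    and "transpose g0 = g0" and "invertible g0"
    and "open U" and "smooth_on U \<phi>"
    and rho: "\<rho> = (\<lambda>x. 1 + \<epsilon> * (\<Sum>\<mu>\<in>UNIV. \<Sum>\<nu>\<in>UNIV.
                 matrix_inv g0 $ \<mu> $ \<nu> * partial \<mu> \<phi> x * partial \<nu> \<phi> x))"
    and "\<And>x. x \<in> U \<Longrightarrow> \<rho> x > 0"
    and h: "h = (\<lambda>x. \<chi> \<mu> \<nu>. g0 $ \<mu> $ \<nu> + \<epsilon> * partial \<mu> \<phi> x * partial \<nu> \<phi> x)"
    and minimal: "\<And>x. x \<in> U \<Longrightarrow>
           (\<Sum>\<mu>\<in>UNIV. \<Sum>\<nu>\<in>UNIV. matrix_inv (h x) $ \<mu> $ \<nu> * partial \<mu> (partial \<nu> \<phi>) x) = 0"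
    and g: "g = (\<lambda>x. (\<rho> x powr (-1/2)) *\<^sub>R h x)"
    and psi0: "\<psi>0 = (\<lambda>x. - (1/4) * ln (\<rho> x))"
  shows "\<forall>x\<in>U.
      ricci_scalar g x = - (1/4) * (\<Sum>\<alpha>\<in>UNIV. \<Sum>\<beta>\<in>UNIV. matrix_inv (g x) $ \<alpha> $ \<beta> *
          trace (partial \<alpha> (\<lambda>y. matrix_inv (g y)) x ** partial \<beta> g x))
    \<and> (\<forall>\<alpha> \<beta>. ricci g \<alpha> \<beta> x = - ((\<rho> x - 1) / 2) * ricci h \<alpha> \<beta> x)
    \<and> ricci_scalar g x = sqrt (\<rho> x) * ricci_scalar h x - 2 * laplace_beltrami g \<psi>0 x"
proof
  fix x assume x: "x \<in> U"
  interpret M: minimal_graph2 \<epsilon> g0 \<phi> U \<rho> h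
    using assms by unfold_locales auto
  have psi: "\<psi>0 = M.psi"
    by (simp add: psi0 M.psi_def fun_eq_iff)
  \<comment> \<open>The two forms of the metric are compared on \<open>U\<close> only. This
    suffices, because every quantity in the claim is local and \<open>U\<close> is open.\<close>
  have gU: "g y = M.g y" if "y \<in> U" for y
    using that by (simp add: g M.g_def M.exp_psi)
  have ric: "ricci g \<alpha> \<beta> x = ricci M.g \<alpha> \<beta> x" for \<alpha> \<beta>
    by (rule ricci_cong[OF \<open>open U\<close> x gU])
  have "ricci_scalar g x = ricci_scalar M.g x"
    by (simp add: ricci_scalar_def ric gU x)
  moreover have "partial \<alpha> g x = partial \<alpha> M.g x"
    "partial \<alpha> (\<lambda>y. matrix_inv (g y)) x = partial \<alpha> (\<lambda>y. matrix_inv (M.g y)) x" for \<alpha>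
    by (rule partial_cong[OF \<open>open U\<close> x]; simp add: gU)+
  moreover have "laplace_beltrami g \<psi>0 x = laplace_beltrami M.g M.psi x"
    unfolding laplace_beltrami_def psi gU[OF x]
    by (intro arg_cong[where f = "(*) _"] sum.cong refl partial_cong[OF \<open>open U\<close> x]) (simp add: gU)
  ultimately show "ricci_scalar g x = - (1/4) * (\<Sum>\<alpha>\<in>UNIV. \<Sum>\<beta>\<in>UNIV. matrix_inv (g x) $ \<alpha> $ \<beta> *
          trace (partial \<alpha> (\<lambda>y. matrix_inv (g y)) x ** partial \<beta> g x))
    \<and> (\<forall>\<alpha> \<beta>. ricci g \<alpha> \<beta> x = - ((\<rho> x - 1) / 2) * ricci h \<alpha> \<beta> x)
    \<and> ricci_scalar g x = sqrt (\<rho> x) * ricci_scalar h x - 2 * laplace_beltrami g \<psi>0 x"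
    using M.curvature_identities[OF x] M.ricci_g_eq[OF x] ric by (simp only: gU[OF x]) simp
qed

end
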